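(* Let $d\ge 3$ and let ${\rm F}_d\subset\mathbb{P}^3(\mathbb{C})$ be the Fermat surface $x^d-y^d-z^d+w^d=0$. Let $\mathfrak{s}({\rm F}_d)$ denote the maximal number of pairwise disjoint lines contained in ${\rm F}_d$. Then $\mathfrak{s}({\rm F}_d)=3d$ for all $d\ge 3$ with $d\neq 3,5$, while $\mathfrak{s}({\rm F}_3)=6$ and $\mathfrak{s}({\rm F}_5)=13$.
   Context: Lines are projective lines in $\mathbb{P}^3(\mathbb{C})$; "pairwise disjoint" (skew) means no two of them intersect. *)

theory Defs
  imports "HOL-Analysis.Analysis"
begin

text \<open>Homogeneous coordinates of P^3(C): nonzero vectors in complex^4,
  with coordinates x = v$1, y = v$2, z = v$3, w = v$4.
  A projective line is the projectivisation of a 2-dimensional complex linear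
  subspace of complex^4; we represent it by that subspace.\<close>

definition cind :: "complex^4 \<Rightarrow> complex^4 \<Rightarrow> bool" where
  "cind u v \<longleftrightarrow> (\<forall>a b::complex. a *s u + b *s v = 0 \<longrightarrow> a = 0 \<and> b = 0)"

definition cspan2 :: "complex^4 \<Rightarrow> complex^4 \<Rightarrow> (complex^4) set" where
  "cspan2 u v = {a *s u + b *s v | a b. True}"

definition proj_line :: "(complex^4) set \<Rightarrow> bool" where
  "proj_line L \<longleftrightarrow> (\<exists>u v. cind u v \<and> L = cspan2 u v)"

definition fermat_point :: "nat \<Rightarrow> complex^4 \<Rightarrow> bool" where
  "fermat_point d p \<longleftrightarrow> (p$1)^d - (p$2)^d - (p$3)^d + (p$4)^d = 0"

definition line_on_fermat :: "nat \<Rightarrow> (complex^4) set \<Rightarrow> bool" where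
  "line_on_fermat d L \<longleftrightarrow> proj_line L \<and> (\<forall>p\<in>L. fermat_point d p)"

text \<open>Two projective lines are disjoint iff the subspaces meet only in 0.\<close>
definition skew_family :: "nat \<Rightarrow> (complex^4) set set \<Rightarrow> bool" where
  "skew_family d S \<longleftrightarrow> (\<forall>L\<in>S. line_on_fermat d L) \<and>
     (\<forall>L1\<in>S. \<forall>L2\<in>S. L1 \<noteq> L2 \<longrightarrow> L1 \<inter> L2 = {0})"

definition max_skew_lines :: "nat \<Rightarrow> nat \<Rightarrow> bool" where
  "max_skew_lines d n \<longleftrightarrow> (\<exists>S. skew_family d S \<and> finite S \<and> card S = n) \<and>
     (\<forall>S. skew_family d S \<longrightarrow> finite S \<and> card S \<le> n)"

end

theory Submission
  imports Defs "HOL-Library.Real_Mod"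
begin

text \<open>A line on the surface gives four linear forms in two variables whose \<open>d\<close>-th powers satisfy
  a linear relation. Four pairwise non-proportional forms have independent \<open>d\<close>-th powers for
  \<open>d \<ge> 3\<close>, so the first form is proportional to another one, and this forces the line into one of
  three families of \<open>d\<^sup>2\<close> lines, each indexed by pairs of \<open>d\<close>-th roots of 1 or of -1.

  Skew lines of one family differ in both parameters, so each family contributes at most \<open>d\<close>
  lines. Lines of different families meet iff certain products or quotients of the parameters
  agree. For \<open>d\<close> an odd prime, the products (and the quotients) of a family with \<open>d\<close> lines
  multiply to 1, hence do not take exactly two values; counting the remaining possibilities gives
  the bounds 6 and 13 for \<open>d = 3\<close> and \<open>d = 5\<close>.

  For the lower bound the parameters are written as powers of a primitive root, so that three
  permutations of \<open>\<int>/d\<close> are needed whose sums and differences avoid each other. For even \<open>d\<close> affine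
  maps separated by parity suffice. For odd \<open>d \<ge> 9\<close> two of them are shifts of an involution
  by adjacent swaps, which has differences in \<open>{-1, 0, 1}\<close>, and the third is a 4-cycle.\<close>

section \<open>The three families of lines\<close>

text \<open>Equations instead of a spanning pair: a point common to two such lines is then a
  solution of four explicit linear equations.\<close>

definition pline :: "4 \<Rightarrow> 4 \<Rightarrow> 4 \<Rightarrow> 4 \<Rightarrow> complex \<Rightarrow> complex \<Rightarrow> (complex^4) set" where
  "pline i j k l \<alpha> \<beta> = {v. v$i = \<alpha> * v$j \<and> v$k = \<beta> * v$l}"

text \<open>The families \<open>lineA\<close>, \<open>lineB\<close>, \<open>lineC\<close> come from
  the three ways to split the Fermat form into two binomials: \<open>x^d - y^d\<close> with
  \<open>w^d - z^d\<close>, \<open>x^d - z^d\<close> with \<open>w^d - y^d\<close>, and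
  \<open>x^d + w^d\<close> with \<open>y^d + z^d\<close>. The parameters are roots of 1 in the first
  two cases and roots of -1 in the third.\<close>

definition lineA :: "complex \<times> complex \<Rightarrow> (complex^4) set" where
  "lineA = (\<lambda>(\<alpha>, \<beta>). pline 1 2 4 3 \<alpha> \<beta>)"

definition lineB :: "complex \<times> complex \<Rightarrow> (complex^4) set" where
  "lineB = (\<lambda>(\<alpha>, \<beta>). pline 1 3 4 2 \<alpha> \<beta>)"

definition lineC :: "complex \<times> complex \<Rightarrow> (complex^4) set" where
  "lineC = (\<lambda>(\<alpha>, \<beta>). pline 1 4 2 3 \<alpha> \<beta>)"

definition roots :: "nat \<Rightarrow> complex \<Rightarrow> complex set" where
  "roots d e = {z. z ^ d = e}"

section \<open>Linear relations between powers of linear forms\<close>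

text \<open>The power sum is a polynomial in \<open>t\<close> that vanishes everywhere, so each of
  its coefficients is 0, and the binomial factor \<open>d choose k\<close> can be cancelled.\<close>

lemma power_sum_coeffs_eq_0:
  fixes u v :: "'i \<Rightarrow> complex" and c :: "'i \<Rightarrow> complex"
  assumes "finite I" and eq: "\<And>t. (\<Sum>i\<in>I. c i * (u i + t * v i) ^ d) = 0" and "k \<le> d"
  shows "(\<Sum>i\<in>I. c i * u i ^ (d - k) * v i ^ k) = 0"
proof -
  have "(\<Sum>k\<le>d. (of_nat (d choose k) * (\<Sum>i\<in>I. c i * u i ^ (d - k) * v i ^ k)) * t ^ k) = 0" for t
  proof -
    have "(\<Sum>i\<in>I. c i * (u i + t * v i) ^ d)
        = (\<Sum>i\<in>I. \<Sum>k\<le>d. of_nat (d choose k) * (c i * u i ^ (d - k) * v i ^ k) * t ^ k)"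
    proof (rule sum.cong)
      fix i assume "i \<in> I"
      have "(u i + t * v i) ^ d = (t * v i + u i) ^ d" by (simp add: add.commute)
      also have "\<dots> = (\<Sum>k\<le>d. of_nat (d choose k) * (t * v i) ^ k * u i ^ (d - k))"
        by (rule binomial_ring)
      finally show "c i * (u i + t * v i) ^ d
        = (\<Sum>k\<le>d. of_nat (d choose k) * (c i * u i ^ (d - k) * v i ^ k) * t ^ k)"
        by (simp add: sum_distrib_left power_mult_distrib mult_ac)
    qed simp
    also have "\<dots> = (\<Sum>k\<le>d. \<Sum>i\<in>I. of_nat (d choose k) * (c i * u i ^ (d - k) * v i ^ k) * t ^ k)"
      by (rule sum.swap)
    finally show ?thesis
      using eq[of t] by (simp add: sum_distrib_left sum_distrib_right)
  qed
  then have "of_nat (d choose k) * (\<Sum>i\<in>I. c i * u i ^ (d - k) * v i ^ k) = 0"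
    using \<open>k \<le> d\<close> polyfun_eq_0[of "\<lambda>k. of_nat (d choose k) * (\<Sum>i\<in>I. c i * u i ^ (d - k) * v i ^ k)" d]
    by blast
  moreover have "(of_nat (d choose k) :: complex) \<noteq> 0"
    using \<open>k \<le> d\<close> by simp
  ultimately show ?thesis by simp
qed

text \<open>Both the first and the last four coefficients of the power sum pair with the cubic
  form that vanishes on the last three of the four linear forms.\<close>

lemma minor_eq_0_of_power_sum:
  fixes u v c :: "4 \<Rightarrow> complex"
  assumes d: "d \<ge> 3" and eq: "\<And>t. (\<Sum>i\<in>UNIV. c i * (u i + t * v i) ^ d) = 0" and c: "c 1 \<noteq> 0"
  shows "\<exists>j\<in>{2,3,4}. u 1 * v j = u j * v 1"
proof (rule ccontr)
  assume neg: "\<not> ?thesis"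
  define m where "m = (\<lambda>x y. (u 2 * y - v 2 * x) * (u 3 * y - v 3 * x) * (u 4 * y - v 4 * x))"
  have m0: "m (u 2) (v 2) = 0" "m (u 3) (v 3) = 0" "m (u 4) (v 4) = 0"
    by (simp_all add: m_def)
  have m1: "m (u 1) (v 1) \<noteq> 0"
    using neg by (auto simp: m_def mult.commute)
  have coeff: "c 1 * u 1 ^ (d - k) * v 1 ^ k + c 2 * u 2 ^ (d - k) * v 2 ^ k
      + c 3 * u 3 ^ (d - k) * v 3 ^ k + c 4 * u 4 ^ (d - k) * v 4 ^ k = 0" if "k \<le> d" for k
    using power_sum_coeffs_eq_0[OF _ eq that] by (simp add: sum_4)
  obtain a0 a1 a2 a3 where m: "m x y = a0 * x^3 + a1 * x^2 * y + a2 * x * y^2 + a3 * y^3" for x y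
  proof
    show "m x y = (- (v 2 * v 3 * v 4)) * x^3
       + (u 2 * v 3 * v 4 + v 2 * u 3 * v 4 + v 2 * v 3 * u 4) * x^2 * y
       + (- (u 2 * u 3 * v 4 + u 2 * v 3 * u 4 + v 2 * u 3 * u 4)) * x * y^2
       + (u 2 * u 3 * u 4) * y^3" for x y
      unfolding m_def by algebra
  qed
  obtain n where n: "d = n + 3" using d by (metis add.commute le_Suc_ex)
  \<comment> \<open>Pairing with the coefficients of \<open>m\<close>: if the four cubic moments
    with weights \<open>c i * f i\<close> vanish, so does the sum of the values of \<open>m\<close>
    with these weights. It is applied with \<open>f i = u i ^ n\<close> and
    \<open>f i = v i ^ n\<close>.\<close>
  have lin: "c 1 * f 1 * m (u 1) (v 1) + c 2 * f 2 * m (u 2) (v 2)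
      + c 3 * f 3 * m (u 3) (v 3) + c 4 * f 4 * m (u 4) (v 4) = 0"
    if h: "\<And>k. k \<le> 3 \<Longrightarrow> c 1 * f 1 * (u 1 ^ (3 - k) * v 1 ^ k) + c 2 * f 2 * (u 2 ^ (3 - k) * v 2 ^ k)
      + c 3 * f 3 * (u 3 ^ (3 - k) * v 3 ^ k) + c 4 * f 4 * (u 4 ^ (3 - k) * v 4 ^ k) = 0"
    for f :: "4 \<Rightarrow> complex"
  proof -
    let ?h = "\<lambda>k. c 1 * f 1 * (u 1 ^ (3 - k) * v 1 ^ k) + c 2 * f 2 * (u 2 ^ (3 - k) * v 2 ^ k)
      + c 3 * f 3 * (u 3 ^ (3 - k) * v 3 ^ k) + c 4 * f 4 * (u 4 ^ (3 - k) * v 4 ^ k)"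
    have "c 1 * f 1 * m (u 1) (v 1) + c 2 * f 2 * m (u 2) (v 2)
      + c 3 * f 3 * m (u 3) (v 3) + c 4 * f 4 * m (u 4) (v 4)
      = a0 * ?h 0 + a1 * ?h 1 + a2 * ?h 2 + a3 * ?h 3"
      unfolding m by (simp add: algebra_simps)
    also have "\<dots> = 0" by (simp only: h) simp
    finally show ?thesis .
  qed
  have "c 1 * u 1 ^ n * m (u 1) (v 1) + c 2 * u 2 ^ n * m (u 2) (v 2)
      + c 3 * u 3 ^ n * m (u 3) (v 3) + c 4 * u 4 ^ n * m (u 4) (v 4) = 0"
  proof (rule lin)
    fix k :: nat assume k: "k \<le> 3"
    have "u i ^ (d - k) = u i ^ n * u i ^ (3 - k)" for i
      using k by (simp add: n flip: power_add)
    then show "c 1 * u 1 ^ n * (u 1 ^ (3 - k) * v 1 ^ k) + c 2 * u 2 ^ n * (u 2 ^ (3 - k) * v 2 ^ k)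
      + c 3 * u 3 ^ n * (u 3 ^ (3 - k) * v 3 ^ k) + c 4 * u 4 ^ n * (u 4 ^ (3 - k) * v 4 ^ k) = 0"
      using coeff[of k] k d by (simp add: mult.assoc)
  qed
  moreover have "c 1 * v 1 ^ n * m (u 1) (v 1) + c 2 * v 2 ^ n * m (u 2) (v 2)
      + c 3 * v 3 ^ n * m (u 3) (v 3) + c 4 * v 4 ^ n * m (u 4) (v 4) = 0"
  proof (rule lin)
    fix k :: nat assume k: "k \<le> 3"
    have "v i ^ (n + k) = v i ^ n * v i ^ k" "d - (n + k) = 3 - k" for i
      by (simp_all add: n power_add)
    then show "c 1 * v 1 ^ n * (u 1 ^ (3 - k) * v 1 ^ k) + c 2 * v 2 ^ n * (u 2 ^ (3 - k) * v 2 ^ k)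
      + c 3 * v 3 ^ n * (u 3 ^ (3 - k) * v 3 ^ k) + c 4 * v 4 ^ n * (u 4 ^ (3 - k) * v 4 ^ k) = 0"
      using coeff[of "n + k"] k by (simp add: n mult_ac)
  qed
  \<comment> \<open>By \<open>m0\<close> only the first summand survives in each sum. For
    \<open>n = 0\<close> the result \<open>1 = 0\<close> is already absurd; otherwise the first form
    is zero, which contradicts \<open>m1\<close>.\<close>
  ultimately have "u 1 ^ n = 0" "v 1 ^ n = 0"
    using c m0 m1 by simp_all
  then have "u 1 = 0" "v 1 = 0" by simp_all
  then show False using m1 by (simp add: m_def)
qed

section \<open>Changing the basis of a line\<close>

lemma cspan2_memI: "x = a *s u + b *s v \<Longrightarrow> x \<in> cspan2 u v"
  unfolding cspan2_def by blast

lemma cspan2_subset: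
  assumes "x \<in> cspan2 u v" "y \<in> cspan2 u v"
  shows "cspan2 x y \<subseteq> cspan2 u v"
proof
  fix z assume "z \<in> cspan2 x y"
  then obtain a b where z: "z = a *s x + b *s y" by (auto simp: cspan2_def)
  obtain x1 x2 y1 y2 where "x = x1 *s u + x2 *s v" "y = y1 *s u + y2 *s v"
    using assms by (auto simp: cspan2_def)
  then have "z = (a * x1 + b * y1) *s u + (a * x2 + b * y2) *s v"
    by (simp add: z vec_eq_iff algebra_simps)
  then show "z \<in> cspan2 u v" by (rule cspan2_memI)
qed

lemma cspan2_exchange_left:
  assumes "cind u v" and p: "p = s *s u + t *s v" and s: "s \<noteq> 0"
  shows "cspan2 u v = cspan2 p v" "cind p v"
proof -
  have "u = (1 / s) *s p + (- t / s) *s v"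
    using s by (simp add: p vec_eq_iff field_simps)
  moreover have "v = 0 *s u + 1 *s v" "v = 0 *s p + 1 *s v" by simp_all
  ultimately show "cspan2 u v = cspan2 p v"
    using p by (intro subset_antisym cspan2_subset) (blast intro: cspan2_memI)+
  show "cind p v"
    unfolding cind_def
  proof (intro allI impI)
    fix a b assume "a *s p + b *s v = 0"
    then have "(a * s) *s u + (a * t + b) *s v = 0"
      by (simp add: p vec_eq_iff algebra_simps)
    then have "a * s = 0" "a * t + b = 0"
      using assms(1) unfolding cind_def by blast+
    then show "a = 0 \<and> b = 0" using s by simp
  qed
qed

lemma cspan2_commute: "cspan2 u v = cspan2 v u"
  by (intro subset_antisym cspan2_subset) (rule cspan2_memI[of _ 0 _ 1] cspan2_memI[of _ 1 _ 0]; simp)+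

lemma cind_commute: "cind u v \<longleftrightarrow> cind v u"
  unfolding cind_def by (metis add.commute)

text \<open>Steinitz exchange: some coefficient of \<open>p\<close> is nonzero, so \<open>p\<close>
  can replace the corresponding basis vector.\<close>

lemma cspan2_exchange:
  assumes "p \<in> cspan2 u v" "p \<noteq> 0" "cind u v"
  obtains r where "cspan2 u v = cspan2 p r" "cind p r"
proof -
  obtain s t where p: "p = s *s u + t *s v" using assms(1) by (auto simp: cspan2_def)
  then consider "s \<noteq> 0" | "t \<noteq> 0" using assms(2) by (cases "s = 0") auto
  then show thesis
  proof cases
    case 1
    then show thesis using that cspan2_exchange_left[OF assms(3) p] by blast
  next
    case 2
    have "p = t *s v + s *s u" using p by (simp add: add.commute)
    then show thesis
      using that cspan2_exchange_left[of v u p t s] 2 assms(3) cspan2_commute cind_commute by metis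
  qed
qed

section \<open>Classification of the lines on the surface\<close>

text \<open>The point \<open>p\<close> is supported on the coordinates \<open>k\<close>,
  \<open>l\<close>. A second basis vector \<open>q\<close> turns out to be supported on
  \<open>i\<close>, \<open>j\<close>. The equation at \<open>p\<close> and at \<open>q\<close> then
  says that the two coordinate ratios are \<open>d\<close>-th roots of \<open>e\<close>.\<close>

lemma line_eq_pline:
  fixes i j k l :: 4
  assumes d: "d \<ge> 2" and idx: "UNIV = {i, j, k, l}"
    and e: "e \<noteq> 0" and c: "c \<noteq> 0"
    and uv: "cind u v"
    and fermat: "\<And>x. x \<in> cspan2 u v \<Longrightarrow> x$i ^ d - e * x$j ^ d + c * (x$k ^ d - e * x$l ^ d) = 0"
    and p: "p \<in> cspan2 u v" "p \<noteq> 0" "p$i = 0" "p$j = 0"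
  shows "\<exists>\<alpha>\<in>roots d e. \<exists>\<beta>\<in>roots d e. cspan2 u v = pline i j k l \<alpha> \<beta>"
proof -
  have all4: "(\<forall>m. P m) \<longleftrightarrow> P i \<and> P j \<and> P k \<and> P l" for P
    using idx by (metis UNIV_I insertE emptyE)
  have z0: "(0::complex) ^ d = 0" using d by (simp add: zero_power)
  have pkl: "p$k ^ d = e * p$l ^ d"
    using fermat[OF p(1)] p c z0 by simp
  have pl: "p$l \<noteq> 0"
  proof
    assume "p$l = 0"
    then have "p$k = 0" using pkl z0 by simp
    with \<open>p$l = 0\<close> p have "p = 0" using all4 by (simp add: vec_eq_iff)
    with p show False by simp
  qed
  then have pk: "p$k \<noteq> 0" using pkl e z0 by (metis mult_eq_0_iff power_not_zero)
  obtain r where r: "cspan2 u v = cspan2 p r" "cind p r"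
    using cspan2_exchange[OF p(1,2) uv] .
  \<comment> \<open>Subtracting a multiple of \<open>p\<close> clears the coordinate
    \<open>l\<close>.\<close>
  define q where "q = r - (r$l / p$l) *s p"
  have ql: "q$l = 0" using pl by (simp add: q_def)
  have pq: "cspan2 u v = cspan2 p q"
  proof -
    have "r = (r$l / p$l) *s p + 1 *s q" "q = (- (r$l / p$l)) *s p + 1 *s r"
      by (simp_all add: q_def vec_eq_iff)
    moreover have "p = 1 *s p + 0 *s x" for x by simp
    ultimately show ?thesis
      unfolding r(1) by (intro subset_antisym cspan2_subset) (blast intro: cspan2_memI)+
  qed
  have q0: "q \<noteq> 0"
  proof
    assume "q = 0"
    moreover have "q = (- (r$l / p$l)) *s p + 1 *s r" by (simp add: q_def vec_eq_iff)
    ultimately have "(- (r$l / p$l)) *s p + 1 *s r = 0" by metis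
    then show False using r(2) unfolding cind_def by (metis one_neq_zero)
  qed
  have mem: "a *s p + b *s q \<in> cspan2 u v" for a b
    unfolding pq by (rule cspan2_memI) (rule refl)
  have eq: "(b * q$i) ^ d - e * (b * q$j) ^ d
      + c * ((a * p$k + b * q$k) ^ d - e * (a * p$l) ^ d) = 0" for a b
    using fermat[OF mem[of a b]] p ql by simp
  have qij0: "q$i ^ d - e * q$j ^ d + c * q$k ^ d = 0"
    using eq[of 1 0] z0 by simp
  \<comment> \<open>The multiple of \<open>p\<close> in \<open>p * (q$k / p$k) + q\<close> doubles
    the coordinate \<open>k\<close>. Comparison with the equation at \<open>q\<close> itself gives
    \<open>2 ^ d = 2\<close>, impossible for \<open>d \<ge> 2\<close>.\<close>
  have qk: "q$k = 0"
  proof (rule ccontr)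
    assume qk: "q$k \<noteq> 0"
    have "(q$k / p$k * p$l) ^ d * e = q$k ^ d"
      using pk pkl pl e by (simp add: power_mult_distrib power_divide field_simps)
    moreover have "q$k / p$k * p$k + q$k = 2 * q$k" using pk by simp
    ultimately have "q$i ^ d - e * q$j ^ d + c * ((2 * q$k) ^ d - q$k ^ d) = 0"
      using eq[of 1 "q$k / p$k"] by (simp add: mult.commute)
    moreover have "c * (X - Y - Y) = (A + c * (X - Y)) - (A + c * Y)" for A X Y :: complex
      by (simp add: algebra_simps)
    ultimately have "c * ((2 * q$k) ^ d - q$k ^ d - q$k ^ d) = 0"
      using qij0 by (metis diff_self)
    then have "(2::complex) ^ d * q$k ^ d = 2 * q$k ^ d"
      using c by (simp add: power_mult_distrib)
    then have "(2::complex) ^ d = 2" using qk by simp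
    then have "cmod (2 ^ d) = 2" by simp
    then have "(2::real) ^ d = 2 ^ 1" by (simp add: norm_power)
    then have "d = 1" using power_inject_exp[of "2::real" d 1] by simp
    then show False using d by simp
  qed
  have qij: "q$i ^ d = e * q$j ^ d" using qij0 qk z0 by simp
  have qj: "q$j \<noteq> 0"
  proof
    assume "q$j = 0"
    then have "q$i = 0" using qij z0 by simp
    with \<open>q$j = 0\<close> ql qk have "q = 0" using all4 by (simp add: vec_eq_iff)
    with q0 show False by simp
  qed
  define \<alpha> \<beta> where "\<alpha> = q$i / q$j" and "\<beta> = p$k / p$l"
  have "\<alpha> ^ d = e" "\<beta> ^ d = e"
    using qij pkl qj pl by (simp_all add: \<alpha>_def \<beta>_def power_divide)
  moreover have "cspan2 u v = pline i j k l \<alpha> \<beta>"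
  proof
    show "cspan2 u v \<subseteq> pline i j k l \<alpha> \<beta>"
      unfolding pq using p(3,4) ql qk pl qj
      by (auto simp: cspan2_def pline_def \<alpha>_def \<beta>_def field_simps)
    show "pline i j k l \<alpha> \<beta> \<subseteq> cspan2 u v"
    proof
      fix x assume "x \<in> pline i j k l \<alpha> \<beta>"
      then have x: "x$i = \<alpha> * x$j" "x$k = \<beta> * x$l" by (simp_all add: pline_def)
      have "x = (x$l / p$l) *s p + (x$j / q$j) *s q"
        unfolding vec_eq_iff all4 using x p ql qk pl qj
        by (simp add: \<alpha>_def \<beta>_def)
      then show "x \<in> cspan2 u v" using mem by metis
    qed
  qed
  ultimately show ?thesis by (auto simp: roots_def)
qed

text \<open>The two coordinate forms are proportional on the line, so a zero of a nonzero one is a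
  zero of both; \<open>v$i *s u - u$i *s v\<close> is such a zero. If both forms vanish on the line,
  any nonzero point serves.\<close>

lemma exists_point_of_minor_eq_0:
  assumes "cind u v" "u$i * v$j = u$j * v$i"
  obtains p where "p \<in> cspan2 u v" "p \<noteq> 0" "p$i = 0" "p$j = 0"
proof -
  have mem: "a *s u + b *s v \<in> cspan2 u v" for a b unfolding cspan2_def by blast
  have ne: "a *s u + b *s v \<noteq> 0" if "a \<noteq> 0 \<or> b \<noteq> 0" for a b
    using assms(1) that by (auto simp: cind_def)
  consider "u$i \<noteq> 0 \<or> v$i \<noteq> 0" | "u$i = 0" "v$i = 0" "u$j \<noteq> 0 \<or> v$j \<noteq> 0"
    | "u$i = 0" "v$i = 0" "u$j = 0" "v$j = 0" by blast
  then show thesis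
  proof cases
    case 1
    show thesis
      by (rule that[OF mem[of "v$i" "- u$i"] ne]) (use 1 assms(2) in \<open>auto simp: algebra_simps\<close>)
  next
    case 2
    show thesis
      by (rule that[OF mem[of "v$j" "- u$j"] ne]) (use 2 in \<open>auto simp: algebra_simps\<close>)
  next
    case 3
    show thesis
      by (rule that[OF mem[of 1 0] ne]) (use 3 in auto)
  qed
qed

lemma line_on_fermat_cases:
  assumes d: "d \<ge> 3" and L: "line_on_fermat d L"
  shows "L \<in> lineA ` (roots d 1 \<times> roots d 1) \<union> lineB ` (roots d 1 \<times> roots d 1)
           \<union> lineC ` (roots d (-1) \<times> roots d (-1))"
proof -
  obtain u v where uv: "cind u v" and Luv: "L = cspan2 u v"
    using L by (auto simp: line_on_fermat_def proj_line_def)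
  have fermat: "x$1 ^ d - x$2 ^ d - x$3 ^ d + x$4 ^ d = 0" if "x \<in> cspan2 u v" for x
    using L that by (auto simp: Luv line_on_fermat_def fermat_point_def)
  \<comment> \<open>The signs of the Fermat form. The points \<open>u + t *s v\<close> of the line
    supply the vanishing power sum.\<close>
  define c :: "4 \<Rightarrow> complex" where "c = (\<lambda>i. if i = 2 \<or> i = 3 then -1 else 1)"
  have c: "c 1 = 1" "c 2 = -1" "c 3 = -1" "c 4 = 1" by (simp_all add: c_def)
  have "(\<Sum>i\<in>UNIV. c i * (u$i + t * v$i) ^ d) = 0" for t
  proof -
    have "1 *s u + t *s v \<in> cspan2 u v" unfolding cspan2_def by blast
    from fermat[OF this] show ?thesis by (simp add: sum_4 c)
  qed
  from minor_eq_0_of_power_sum[OF d this]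
  have "\<exists>j\<in>{2,3,4}. u$1 * v$j = u$j * v$1" by (simp add: c)
  then obtain j where j: "j = 2 \<or> j = 3 \<or> j = (4::4)" and "u$1 * v$j = u$j * v$1"
    by auto
  then obtain p where p: "p \<in> cspan2 u v" "p \<noteq> 0" "p$1 = 0" "p$j = 0"
    using exists_point_of_minor_eq_0[OF uv] by blast
  have d2: "d \<ge> 2" using d by simp
  from j consider "j = 2" | "j = 3" | "j = 4" by blast
  then show ?thesis
  proof cases
    case 1
    have "\<exists>\<alpha>\<in>roots d 1. \<exists>\<beta>\<in>roots d 1. cspan2 u v = pline 1 2 4 3 \<alpha> \<beta>"
      by (rule line_eq_pline[OF d2 _ _ _ uv _ p(1-3), of _ _ _ 1 1])
         (use p 1 fermat UNIV_4 in \<open>auto simp: algebra_simps\<close>)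
    then show ?thesis by (force simp: Luv lineA_def)
  next
    case 2
    have "\<exists>\<alpha>\<in>roots d 1. \<exists>\<beta>\<in>roots d 1. cspan2 u v = pline 1 3 4 2 \<alpha> \<beta>"
      by (rule line_eq_pline[OF d2 _ _ _ uv _ p(1-3), of _ _ _ 1 1])
         (use p 2 fermat UNIV_4 in \<open>auto simp: algebra_simps\<close>)
    then show ?thesis by (force simp: Luv lineB_def)
  next
    case 3
    \<comment> \<open>With \<open>e = c = -1\<close> the form reads
      \<open>x^d + w^d - (y^d + z^d)\<close>; the two cases before use
      \<open>e = c = 1\<close>.\<close>
    have "\<exists>\<alpha>\<in>roots d (-1). \<exists>\<beta>\<in>roots d (-1). cspan2 u v = pline 1 4 2 3 \<alpha> \<beta>"
      by (rule line_eq_pline[OF d2 _ _ _ uv _ p(1-3), of _ _ _ "-1" "-1"])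
         (use p 3 fermat UNIV_4 in \<open>auto simp: algebra_simps\<close>)
    then show ?thesis by (force simp: Luv lineC_def)
  qed
qed

section \<open>Incidence between lines of the families\<close>

lemma vector_4:
  fixes w x y z :: "'a::zero"
  shows "(vector [w, x, y, z] :: 'a^4)$1 = w" "(vector [w, x, y, z] :: 'a^4)$2 = x"
    "(vector [w, x, y, z] :: 'a^4)$3 = y" "(vector [w, x, y, z] :: 'a^4)$4 = z"
  unfolding vector_def by simp_all

lemma vec4_eq_0_iff: "(v :: complex^4) = 0 \<longleftrightarrow> v$1 = 0 \<and> v$2 = 0 \<and> v$3 = 0 \<and> v$4 = 0"
  by (simp add: vec_eq_iff forall_4)

lemma inter_eq_0_iff:
  fixes L M :: "(complex^4) set"
  assumes "0 \<in> L" "0 \<in> M"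
  shows "L \<inter> M = {0} \<longleftrightarrow> (\<forall>v. v \<in> L \<longrightarrow> v \<in> M \<longrightarrow> v = 0)"
  using assms by blast

lemma zero_in_line: "0 \<in> lineA p" "0 \<in> lineB p" "0 \<in> lineC p"
  by (auto simp: lineA_def lineB_def lineC_def pline_def split: prod.split)

text \<open>Each line joins a point of \<open>z = w = 0\<close> determined by \<alpha> alone to a
  point of \<open>x = y = 0\<close> determined by \<beta> alone, so a shared parameter means a
  shared point. If both parameters differ, the four equations force every coordinate to vanish. The
  other two families behave alike.\<close>

lemma lineA_skew_iff:
  "lineA (\<alpha>, \<beta>) \<inter> lineA (\<alpha>', \<beta>') = {0} \<longleftrightarrow> \<alpha> \<noteq> \<alpha>' \<and> \<beta> \<noteq> \<beta>'"
proof -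
  have "\<not> (lineA (\<alpha>, \<beta>) \<inter> lineA (\<alpha>', \<beta>') = {0})" if "\<alpha> = \<alpha>' \<or> \<beta> = \<beta>'"
  proof -
    have "vector [\<alpha>, 1, 0, 0] \<in> lineA (\<alpha>, \<gamma>)" "vector [0, 0, 1, \<beta>] \<in> lineA (\<gamma>, \<beta>)" for \<gamma>
      by (auto simp: lineA_def pline_def vector_4)
    moreover have "vector [\<alpha>, 1, 0, 0] \<noteq> (0 :: complex^4)" "vector [0, 0, 1, \<beta>] \<noteq> (0 :: complex^4)"
      by (auto simp: vec4_eq_0_iff vector_4)
    ultimately show ?thesis using that by blast
  qed
  moreover have "lineA (\<alpha>, \<beta>) \<inter> lineA (\<alpha>', \<beta>') = {0}" if "\<alpha> \<noteq> \<alpha>' \<and> \<beta> \<noteq> \<beta>'"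
    unfolding inter_eq_0_iff[OF zero_in_line(1) zero_in_line(1)]
    using that by (auto simp: lineA_def pline_def vec4_eq_0_iff)
  ultimately show ?thesis by blast
qed

lemma lineB_skew_iff:
  "lineB (\<alpha>, \<beta>) \<inter> lineB (\<alpha>', \<beta>') = {0} \<longleftrightarrow> \<alpha> \<noteq> \<alpha>' \<and> \<beta> \<noteq> \<beta>'"
proof -
  have "\<not> (lineB (\<alpha>, \<beta>) \<inter> lineB (\<alpha>', \<beta>') = {0})" if "\<alpha> = \<alpha>' \<or> \<beta> = \<beta>'"
  proof -
    have "vector [\<alpha>, 0, 1, 0] \<in> lineB (\<alpha>, \<gamma>)" "vector [0, 1, 0, \<beta>] \<in> lineB (\<gamma>, \<beta>)" for \<gamma>
      by (auto simp: lineB_def pline_def vector_4)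
    moreover have "vector [\<alpha>, 0, 1, 0] \<noteq> (0 :: complex^4)" "vector [0, 1, 0, \<beta>] \<noteq> (0 :: complex^4)"
      by (auto simp: vec4_eq_0_iff vector_4)
    ultimately show ?thesis using that by blast
  qed
  moreover have "lineB (\<alpha>, \<beta>) \<inter> lineB (\<alpha>', \<beta>') = {0}" if "\<alpha> \<noteq> \<alpha>' \<and> \<beta> \<noteq> \<beta>'"
    unfolding inter_eq_0_iff[OF zero_in_line(2) zero_in_line(2)]
    using that by (auto simp: lineB_def pline_def vec4_eq_0_iff)
  ultimately show ?thesis by blast
qed

lemma lineC_skew_iff:
  "lineC (\<alpha>, \<beta>) \<inter> lineC (\<alpha>', \<beta>') = {0} \<longleftrightarrow> \<alpha> \<noteq> \<alpha>' \<and> \<beta> \<noteq> \<beta>'"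
proof -
  have "\<not> (lineC (\<alpha>, \<beta>) \<inter> lineC (\<alpha>', \<beta>') = {0})" if "\<alpha> = \<alpha>' \<or> \<beta> = \<beta>'"
  proof -
    have "vector [\<alpha>, 0, 0, 1] \<in> lineC (\<alpha>, \<gamma>)" "vector [0, \<beta>, 1, 0] \<in> lineC (\<gamma>, \<beta>)" for \<gamma>
      by (auto simp: lineC_def pline_def vector_4)
    moreover have "vector [\<alpha>, 0, 0, 1] \<noteq> (0 :: complex^4)" "vector [0, \<beta>, 1, 0] \<noteq> (0 :: complex^4)"
      by (auto simp: vec4_eq_0_iff vector_4)
    ultimately show ?thesis using that by blast
  qed
  moreover have "lineC (\<alpha>, \<beta>) \<inter> lineC (\<alpha>', \<beta>') = {0}" if "\<alpha> \<noteq> \<alpha>' \<and> \<beta> \<noteq> \<beta>'"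
    unfolding inter_eq_0_iff[OF zero_in_line(3) zero_in_line(3)]
    using that by (auto simp: lineC_def pline_def vec4_eq_0_iff)
  ultimately show ?thesis by blast
qed

text \<open>On a common point \<alpha>y = \<gamma>z and \<beta>z = \<delta>y, whence
  \<alpha>\<beta>y = \<gamma>\<delta>y. The witness for the converse solves the first equation by
  \<open>y = \<gamma>\<close>, \<open>z = \<alpha>\<close>.\<close>

lemma lineA_lineB_skew_iff:
  assumes "\<alpha> \<noteq> 0" "\<gamma> \<noteq> 0"
  shows "lineA (\<alpha>, \<beta>) \<inter> lineB (\<gamma>, \<delta>) = {0} \<longleftrightarrow> \<alpha> * \<beta> \<noteq> \<gamma> * \<delta>"
proof -
  have "\<not> (lineA (\<alpha>, \<beta>) \<inter> lineB (\<gamma>, \<delta>) = {0})" if "\<alpha> * \<beta> = \<gamma> * \<delta>"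
  proof -
    have "vector [\<alpha> * \<gamma>, \<gamma>, \<alpha>, \<alpha> * \<beta>] \<in> lineA (\<alpha>, \<beta>) \<inter> lineB (\<gamma>, \<delta>)"
      using that by (auto simp: lineA_def lineB_def pline_def vector_4 mult.commute)
    moreover have "vector [\<alpha> * \<gamma>, \<gamma>, \<alpha>, \<alpha> * \<beta>] \<noteq> (0 :: complex^4)"
      using assms by (auto simp: vec4_eq_0_iff vector_4)
    ultimately show ?thesis by blast
  qed
  moreover have "\<alpha> * \<beta> = \<gamma> * \<delta>"
    if v: "v \<in> lineA (\<alpha>, \<beta>)" "v \<in> lineB (\<gamma>, \<delta>)" "v \<noteq> 0" for v
  proof -
    have e: "v$1 = \<alpha> * v$2" "v$4 = \<beta> * v$3" "v$1 = \<gamma> * v$3" "v$4 = \<delta> * v$2"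
      using v by (auto simp: lineA_def lineB_def pline_def)
    then have "v$2 \<noteq> 0"
      using v(3) assms by (auto simp: vec4_eq_0_iff)
    moreover have "(\<alpha> * \<beta>) * v$2 = (\<gamma> * \<delta>) * v$2" using e by algebra
    ultimately show ?thesis by simp
  qed
  ultimately show ?thesis
    using inter_eq_0_iff[OF zero_in_line(1) zero_in_line(2)] by blast
qed

text \<open>The coordinate \<open>x\<close> is expressed through \<open>z\<close> in two ways, via
  \<open>y\<close> as \<alpha>\<delta>z and via \<open>w\<close> as \<gamma>\<beta>z; the witness
  has \<open>z = 1\<close>.\<close>

lemma lineA_lineC_skew_iff:
  assumes "\<alpha> \<noteq> 0" "\<beta> \<noteq> 0" "\<gamma> \<noteq> 0"
  shows "lineA (\<alpha>, \<beta>) \<inter> lineC (\<gamma>, \<delta>) = {0} \<longleftrightarrow> \<alpha> * \<delta> \<noteq> \<gamma> * \<beta>"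
proof -
  have "\<not> (lineA (\<alpha>, \<beta>) \<inter> lineC (\<gamma>, \<delta>) = {0})" if "\<alpha> * \<delta> = \<gamma> * \<beta>"
  proof -
    have "vector [\<alpha> * \<delta>, \<delta>, 1, \<beta>] \<in> lineA (\<alpha>, \<beta>) \<inter> lineC (\<gamma>, \<delta>)"
      using that by (auto simp: lineA_def lineC_def pline_def vector_4)
    moreover have "vector [\<alpha> * \<delta>, \<delta>, 1, \<beta>] \<noteq> (0 :: complex^4)"
      by (auto simp: vec4_eq_0_iff vector_4)
    ultimately show ?thesis by blast
  qed
  moreover have "\<alpha> * \<delta> = \<gamma> * \<beta>"
    if v: "v \<in> lineA (\<alpha>, \<beta>)" "v \<in> lineC (\<gamma>, \<delta>)" "v \<noteq> 0" for v
  proof -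
    have e: "v$1 = \<alpha> * v$2" "v$4 = \<beta> * v$3" "v$1 = \<gamma> * v$4" "v$2 = \<delta> * v$3"
      using v by (auto simp: lineA_def lineC_def pline_def)
    then have "v$3 \<noteq> 0"
      using v(3) assms by (auto simp: vec4_eq_0_iff)
    moreover have "(\<alpha> * \<delta>) * v$3 = (\<gamma> * \<beta>) * v$3" using e by algebra
    ultimately show ?thesis by simp
  qed
  ultimately show ?thesis
    using inter_eq_0_iff[OF zero_in_line(1) zero_in_line(3)] by blast
qed

text \<open>Again \<open>x\<close> is compared with \<open>z\<close>: directly it is \<alpha>z, and
  via \<open>w\<close> and \<open>y\<close> it is \<gamma>\<beta>\<delta>z.\<close>

lemma lineB_lineC_skew_iff:
  assumes "\<alpha> \<noteq> 0" "\<beta> \<noteq> 0" "\<gamma> \<noteq> 0"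
  shows "lineB (\<alpha>, \<beta>) \<inter> lineC (\<gamma>, \<delta>) = {0} \<longleftrightarrow> \<alpha> \<noteq> \<beta> * (\<gamma> * \<delta>)"
proof -
  have "\<not> (lineB (\<alpha>, \<beta>) \<inter> lineC (\<gamma>, \<delta>) = {0})" if "\<alpha> = \<beta> * (\<gamma> * \<delta>)"
  proof -
    have "vector [\<alpha>, \<delta>, 1, \<beta> * \<delta>] \<in> lineB (\<alpha>, \<beta>) \<inter> lineC (\<gamma>, \<delta>)"
      using that by (auto simp: lineB_def lineC_def pline_def vector_4)
    moreover have "vector [\<alpha>, \<delta>, 1, \<beta> * \<delta>] \<noteq> (0 :: complex^4)"
      by (auto simp: vec4_eq_0_iff vector_4)
    ultimately show ?thesis by blast
  qed
  moreover have "\<alpha> = \<beta> * (\<gamma> * \<delta>)"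
    if v: "v \<in> lineB (\<alpha>, \<beta>)" "v \<in> lineC (\<gamma>, \<delta>)" "v \<noteq> 0" for v
  proof -
    have e: "v$1 = \<alpha> * v$3" "v$4 = \<beta> * v$2" "v$1 = \<gamma> * v$4" "v$2 = \<delta> * v$3"
      using v by (auto simp: lineB_def lineC_def pline_def)
    then have "v$3 \<noteq> 0"
      using v(3) assms by (auto simp: vec4_eq_0_iff)
    moreover have "\<alpha> * v$3 = (\<beta> * (\<gamma> * \<delta>)) * v$3" using e by algebra
    ultimately show ?thesis by simp
  qed
  ultimately show ?thesis
    using inter_eq_0_iff[OF zero_in_line(2) zero_in_line(3)] by blast
qed

lemma lineA_inj: "lineA (\<alpha>, \<beta>) = lineA (\<alpha>', \<beta>') \<Longrightarrow> \<alpha> = \<alpha>' \<and> \<beta> = \<beta>'"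
proof -
  assume eq: "lineA (\<alpha>, \<beta>) = lineA (\<alpha>', \<beta>')"
  have "vector [\<alpha>, 1, 1, \<beta>] \<in> lineA (\<alpha>, \<beta>)" by (simp add: lineA_def pline_def vector_4)
  then show ?thesis unfolding eq by (simp add: lineA_def pline_def vector_4)
qed

lemma lineB_inj: "lineB (\<alpha>, \<beta>) = lineB (\<alpha>', \<beta>') \<Longrightarrow> \<alpha> = \<alpha>' \<and> \<beta> = \<beta>'"
proof -
  assume eq: "lineB (\<alpha>, \<beta>) = lineB (\<alpha>', \<beta>')"
  have "vector [\<alpha>, 1, 1, \<beta>] \<in> lineB (\<alpha>, \<beta>)" by (simp add: lineB_def pline_def vector_4)
  then show ?thesis unfolding eq by (simp add: lineB_def pline_def vector_4)
qed

lemma lineC_inj: "lineC (\<alpha>, \<beta>) = lineC (\<alpha>', \<beta>') \<Longrightarrow> \<alpha> = \<alpha>' \<and> \<beta> = \<beta>'"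
proof -
  assume eq: "lineC (\<alpha>, \<beta>) = lineC (\<alpha>', \<beta>')"
  have "vector [\<alpha>, \<beta>, 1, 1] \<in> lineC (\<alpha>, \<beta>)" by (simp add: lineC_def pline_def vector_4)
  then show ?thesis unfolding eq by (simp add: lineC_def pline_def vector_4)
qed

text \<open>Members of a skew family are either equal or disjoint; this rules out equality across
  families, so that the incidence criteria apply.\<close>

lemma lines_distinct:
  assumes "\<alpha> \<noteq> 0"
  shows "lineA (\<alpha>, \<beta>) \<noteq> lineB (\<gamma>, \<delta>)" "lineA (\<alpha>, \<beta>) \<noteq> lineC (\<gamma>, \<delta>)" "lineB (\<alpha>, \<beta>) \<noteq> lineC (\<gamma>, \<delta>)"
proof -
  have "vector [\<alpha>, 1, 0, 0] \<in> lineA (\<alpha>, \<beta>)" "vector [\<alpha>, 0, 1, 0] \<in> lineB (\<alpha>, \<beta>)"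
    by (simp_all add: lineA_def lineB_def pline_def vector_4)
  moreover have "vector [\<alpha>, 1, 0, 0] \<notin> lineB (\<gamma>, \<delta>)" "vector [\<alpha>, 1, 0, 0] \<notin> lineC (\<gamma>, \<delta>)"
    "vector [\<alpha>, 0, 1, 0] \<notin> lineC (\<gamma>, \<delta>)"
    using assms by (simp_all add: lineB_def lineC_def pline_def vector_4)
  ultimately show "lineA (\<alpha>, \<beta>) \<noteq> lineB (\<gamma>, \<delta>)" "lineA (\<alpha>, \<beta>) \<noteq> lineC (\<gamma>, \<delta>)" "lineB (\<alpha>, \<beta>) \<noteq> lineC (\<gamma>, \<delta>)"
    by metis+
qed

text \<open>A line and itself fail the skewness criterion. Hence disjoint lines are distinct, which
  is what the count of a constructed family needs.\<close>

lemma line_nontrivial: "lineA p \<noteq> {0}" "lineB p \<noteq> {0}" "lineC p \<noteq> {0}"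
  using lineA_skew_iff[of "fst p" "snd p" "fst p" "snd p"]
    lineB_skew_iff[of "fst p" "snd p" "fst p" "snd p"]
    lineC_skew_iff[of "fst p" "snd p" "fst p" "snd p"] by auto

section \<open>Translation between skew families and parameter sets\<close>

lemma proj_line_pline:
  assumes "distinct [i, j, k, l]" "UNIV = {i, j, k, l}"
  shows "proj_line (pline i j k l \<alpha> \<beta>)"
proof -
  have all4: "(\<forall>m. P m) \<longleftrightarrow> P i \<and> P j \<and> P k \<and> P l" for P
    using assms(2) by (metis UNIV_I insertE emptyE)
  define u v :: "complex^4" where "u = (\<chi> m. if m = i then \<alpha> else if m = j then 1 else 0)"
    and "v = (\<chi> m. if m = k then \<beta> else if m = l then 1 else 0)"
  have u: "u$i = \<alpha>" "u$j = 1" "u$k = 0" "u$l = 0"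
    and v: "v$i = 0" "v$j = 0" "v$k = \<beta>" "v$l = 1"
    using assms(1) by (auto simp: u_def v_def)
  have "cind u v"
    unfolding cind_def vec_eq_iff all4 by (simp add: u v)
  moreover have "pline i j k l \<alpha> \<beta> = cspan2 u v"
  proof
    show "cspan2 u v \<subseteq> pline i j k l \<alpha> \<beta>"
      by (auto simp: cspan2_def pline_def u v)
    have "x = (x$j) *s u + (x$l) *s v" if "x \<in> pline i j k l \<alpha> \<beta>" for x
      using that unfolding vec_eq_iff all4 by (auto simp: u v pline_def)
    then show "pline i j k l \<alpha> \<beta> \<subseteq> cspan2 u v"
      by (blast intro: cspan2_memI)
  qed
  ultimately show ?thesis unfolding proj_line_def by blast
qed

lemma line_on_fermat_lines:
  "p \<in> roots d 1 \<times> roots d 1 \<Longrightarrow> line_on_fermat d (lineA p)"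
  "p \<in> roots d 1 \<times> roots d 1 \<Longrightarrow> line_on_fermat d (lineB p)"
  "p \<in> roots d (-1) \<times> roots d (-1) \<Longrightarrow> line_on_fermat d (lineC p)"
  unfolding line_on_fermat_def lineA_def lineB_def lineC_def
  using UNIV_4 by (auto intro!: proj_line_pline
      simp: pline_def fermat_point_def power_mult_distrib roots_def)

text \<open>Skewness of \<open>lineA ` P \<union> lineB ` Q \<union> lineC ` R\<close>, expressed in the parameters.\<close>

definition skew_params ::
  "nat \<Rightarrow> (complex \<times> complex) set \<Rightarrow> (complex \<times> complex) set \<Rightarrow> (complex \<times> complex) set \<Rightarrow> bool" where
  "skew_params d P Q R \<longleftrightarrow>
     P \<subseteq> roots d 1 \<times> roots d 1 \<and> Q \<subseteq> roots d 1 \<times> roots d 1 \<and> R \<subseteq> roots d (-1) \<times> roots d (-1) \<and>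
     inj_on fst P \<and> inj_on snd P \<and> inj_on fst Q \<and> inj_on snd Q \<and> inj_on fst R \<and> inj_on snd R \<and>
     (\<forall>(\<alpha>, \<beta>)\<in>P. \<forall>(\<gamma>, \<delta>)\<in>Q. \<alpha> * \<beta> \<noteq> \<gamma> * \<delta>) \<and>
     (\<forall>(\<alpha>, \<beta>)\<in>P. \<forall>(\<gamma>, \<delta>)\<in>R. \<alpha> * \<delta> \<noteq> \<gamma> * \<beta>) \<and>
     (\<forall>(\<alpha>, \<beta>)\<in>Q. \<forall>(\<gamma>, \<delta>)\<in>R. \<alpha> \<noteq> \<beta> * (\<gamma> * \<delta>))"

lemma roots_nonzero: "z \<in> roots d e \<Longrightarrow> d > 0 \<Longrightarrow> e \<noteq> 0 \<Longrightarrow> z \<noteq> 0"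
  by (auto simp: roots_def zero_power)

lemma skew_family_of_skew_params:
  assumes d: "d > 0" and PQR: "skew_params d P Q R" and fin: "finite P" "finite Q" "finite R"
  shows "\<exists>S. skew_family d S \<and> finite S \<and> card S = card P + card Q + card R"
proof -
  have P: "P \<subseteq> roots d 1 \<times> roots d 1" and Q: "Q \<subseteq> roots d 1 \<times> roots d 1"
    and R: "R \<subseteq> roots d (-1) \<times> roots d (-1)"
    using PQR by (auto simp: skew_params_def)
  have AA: "lineA p \<inter> lineA q = {0}" if "p \<in> P" "q \<in> P" "p \<noteq> q" for p q
    using PQR that lineA_skew_iff[of "fst p" "snd p" "fst q" "snd q"]
    by (auto simp: skew_params_def inj_on_def)
  have BB: "lineB p \<inter> lineB q = {0}" if "p \<in> Q" "q \<in> Q" "p \<noteq> q" for p q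
    using PQR that lineB_skew_iff[of "fst p" "snd p" "fst q" "snd q"]
    by (auto simp: skew_params_def inj_on_def)
  have CC: "lineC p \<inter> lineC q = {0}" if "p \<in> R" "q \<in> R" "p \<noteq> q" for p q
    using PQR that lineC_skew_iff[of "fst p" "snd p" "fst q" "snd q"]
    by (auto simp: skew_params_def inj_on_def)
  have AB: "lineA p \<inter> lineB q = {0}" if "p \<in> P" "q \<in> Q" for p q
  proof -
    have "fst p \<noteq> 0" "fst q \<noteq> 0" using that P Q d roots_nonzero[of _ d 1] by auto
    moreover have "fst p * snd p \<noteq> fst q * snd q"
      using PQR that unfolding skew_params_def by (auto simp: split_beta)
    ultimately show ?thesis
      using lineA_lineB_skew_iff[of "fst p" "fst q" "snd p" "snd q"] by simp
  qed
  have AC: "lineA p \<inter> lineC q = {0}" if "p \<in> P" "q \<in> R" for p q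
  proof -
    have "fst p \<noteq> 0" "snd p \<noteq> 0" "fst q \<noteq> 0"
      using that P R d roots_nonzero[of _ d 1] roots_nonzero[of _ d "-1"] by auto
    moreover have "fst p * snd q \<noteq> fst q * snd p"
      using PQR that unfolding skew_params_def by (auto simp: split_beta)
    ultimately show ?thesis
      using lineA_lineC_skew_iff[of "fst p" "snd p" "fst q" "snd q"] by simp
  qed
  have BC: "lineB p \<inter> lineC q = {0}" if "p \<in> Q" "q \<in> R" for p q
  proof -
    have "fst p \<noteq> 0" "snd p \<noteq> 0" "fst q \<noteq> 0"
      using that Q R d roots_nonzero[of _ d 1] roots_nonzero[of _ d "-1"] by auto
    moreover have "fst p \<noteq> snd p * (fst q * snd q)"
      using PQR that unfolding skew_params_def by (auto simp: split_beta)
    ultimately show ?thesis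
      using lineB_lineC_skew_iff[of "fst p" "snd p" "fst q" "snd q"] by simp
  qed
  have BA: "lineB q \<inter> lineA p = {0}" if "p \<in> P" "q \<in> Q" for p q
    using AB[OF that] by (simp add: Int_commute)
  have CA: "lineC q \<inter> lineA p = {0}" if "p \<in> P" "q \<in> R" for p q
    using AC[OF that] by (simp add: Int_commute)
  have CB: "lineC q \<inter> lineB p = {0}" if "p \<in> Q" "q \<in> R" for p q
    using BC[OF that] by (simp add: Int_commute)
  define S where "S = lineA ` P \<union> lineB ` Q \<union> lineC ` R"
  have "skew_family d S"
    unfolding skew_family_def
  proof (intro conjI ballI impI)
    fix L assume "L \<in> S"
    then show "line_on_fermat d L"
      unfolding S_def
      using line_on_fermat_lines(1)[OF subsetD[OF P]] line_on_fermat_lines(2)[OF subsetD[OF Q]]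
        line_on_fermat_lines(3)[OF subsetD[OF R]] by auto
  next
    fix L M assume "L \<in> S" "M \<in> S" "L \<noteq> M"
    then show "L \<inter> M = {0}"
      unfolding S_def
      using AA BB CC AB AC BC BA CA CB by (elim UnE imageE; hypsubst) metis+
  qed
  moreover have "finite S" using fin by (simp add: S_def)
  moreover have "card S = card P + card Q + card R"
  proof -
    have inj: "inj_on lineA P" "inj_on lineB Q" "inj_on lineC R"
      using AA BB CC line_nontrivial by (metis inf.idem inj_onI)+
    have "lineA p \<noteq> lineB q" if "p \<in> P" "q \<in> Q" for p q
      using AB[OF that] line_nontrivial(1)[of p] by auto
    moreover have "lineA p \<noteq> lineC q" if "p \<in> P" "q \<in> R" for p q
      using AC[OF that] line_nontrivial(1)[of p] by auto
    moreover have "lineB p \<noteq> lineC q" if "p \<in> Q" "q \<in> R" for p q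
      using BC[OF that] line_nontrivial(2)[of p] by auto
    ultimately have "lineA ` P \<inter> lineB ` Q = {}" "(lineA ` P \<union> lineB ` Q) \<inter> lineC ` R = {}"
      by blast+
    then show ?thesis
      using fin inj unfolding S_def by (simp add: card_Un_disjoint card_image)
  qed
  ultimately show ?thesis by blast
qed

text \<open>\<open>P\<close>, \<open>Q\<close>, \<open>R\<close> collect all parameters whose line
  belongs to \<open>S\<close>. The classification shows that they exhaust \<open>S\<close>, and the
  incidence criteria turn skewness into conditions on them.\<close>

lemma skew_params_of_skew_family:
  assumes d: "d \<ge> 3" and S: "skew_family d S"
  shows "\<exists>P Q R. skew_params d P Q R \<and> S = lineA ` P \<union> lineB ` Q \<union> lineC ` R"
proof -
  define P where "P = {p \<in> roots d 1 \<times> roots d 1. lineA p \<in> S}"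
  define Q where "Q = {p \<in> roots d 1 \<times> roots d 1. lineB p \<in> S}"
  define R where "R = {p \<in> roots d (-1) \<times> roots d (-1). lineC p \<in> S}"
  have skew: "L = M \<or> L \<inter> M = {0}" if "L \<in> S" "M \<in> S" for L M
    using S that unfolding skew_family_def by blast
  have "S = lineA ` P \<union> lineB ` Q \<union> lineC ` R"
  proof
    show "S \<subseteq> lineA ` P \<union> lineB ` Q \<union> lineC ` R"
    proof
      fix L assume "L \<in> S"
      then have "L \<in> lineA ` (roots d 1 \<times> roots d 1) \<union> lineB ` (roots d 1 \<times> roots d 1)
           \<union> lineC ` (roots d (-1) \<times> roots d (-1))"
        using S by (intro line_on_fermat_cases[OF d]) (simp add: skew_family_def)
      then show "L \<in> lineA ` P \<union> lineB ` Q \<union> lineC ` R"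
        using \<open>L \<in> S\<close> by (elim UnE imageE) (simp_all add: P_def Q_def R_def)
    qed
  qed (auto simp: P_def Q_def R_def)
  moreover have "skew_params d P Q R"
    unfolding skew_params_def
  proof (intro conjI)
    \<comment> \<open>Lines of \<open>S\<close> that share one parameter meet, hence coincide, hence
      share both.\<close>
    have "a = c \<and> b = e" if "(a, b) \<in> P" "(c, e) \<in> P" "a = c \<or> b = e" for a b c e
      using that skew[of "lineA (a, b)" "lineA (c, e)"] lineA_skew_iff[of a b c e] lineA_inj[of a b c e]
      by (auto simp: P_def)
    then show "inj_on fst P" "inj_on snd P"
      by (intro inj_onI; metis prod.collapse)+
    have "a = c \<and> b = e" if "(a, b) \<in> Q" "(c, e) \<in> Q" "a = c \<or> b = e" for a b c e
      using that skew[of "lineB (a, b)" "lineB (c, e)"] lineB_skew_iff[of a b c e] lineB_inj[of a b c e]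
      by (auto simp: Q_def)
    then show "inj_on fst Q" "inj_on snd Q"
      by (intro inj_onI; metis prod.collapse)+
    have "a = c \<and> b = e" if "(a, b) \<in> R" "(c, e) \<in> R" "a = c \<or> b = e" for a b c e
      using that skew[of "lineC (a, b)" "lineC (c, e)"] lineC_skew_iff[of a b c e] lineC_inj[of a b c e]
      by (auto simp: R_def)
    then show "inj_on fst R" "inj_on snd R"
      by (intro inj_onI; metis prod.collapse)+
    have nz: "z \<noteq> 0" if "z \<in> roots d 1 \<or> z \<in> roots d (-1)" for z
      using that d roots_nonzero[of z d 1] roots_nonzero[of z d "-1"] by auto
    show "\<forall>(\<alpha>, \<beta>)\<in>P. \<forall>(\<gamma>, \<delta>)\<in>Q. \<alpha> * \<beta> \<noteq> \<gamma> * \<delta>"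
    proof clarify
      fix \<alpha> \<beta> \<gamma> \<delta> assume h: "(\<alpha>, \<beta>) \<in> P" "(\<gamma>, \<delta>) \<in> Q" "\<alpha> * \<beta> = \<gamma> * \<delta>"
      then have "\<alpha> \<noteq> 0" "\<gamma> \<noteq> 0" using nz by (auto simp: P_def Q_def)
      then show False
        using h skew[of "lineA (\<alpha>, \<beta>)" "lineB (\<gamma>, \<delta>)"] lineA_lineB_skew_iff lines_distinct
        by (auto simp: P_def Q_def)
    qed
    show "\<forall>(\<alpha>, \<beta>)\<in>P. \<forall>(\<gamma>, \<delta>)\<in>R. \<alpha> * \<delta> \<noteq> \<gamma> * \<beta>"
    proof clarify
      fix \<alpha> \<beta> \<gamma> \<delta> assume h: "(\<alpha>, \<beta>) \<in> P" "(\<gamma>, \<delta>) \<in> R" "\<alpha> * \<delta> = \<gamma> * \<beta>"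
      then have "\<alpha> \<noteq> 0" "\<beta> \<noteq> 0" "\<gamma> \<noteq> 0" using nz by (auto simp: P_def R_def)
      then show False
        using h skew[of "lineA (\<alpha>, \<beta>)" "lineC (\<gamma>, \<delta>)"] lineA_lineC_skew_iff lines_distinct
        by (auto simp: P_def R_def)
    qed
    show "\<forall>(\<alpha>, \<beta>)\<in>Q. \<forall>(\<gamma>, \<delta>)\<in>R. \<alpha> \<noteq> \<beta> * (\<gamma> * \<delta>)"
    proof clarify
      fix \<alpha> \<beta> \<gamma> \<delta> assume h: "(\<beta> * (\<gamma> * \<delta>), \<beta>) \<in> Q" "(\<gamma>, \<delta>) \<in> R"
      then have "\<beta> * (\<gamma> * \<delta>) \<noteq> 0" "\<beta> \<noteq> 0" "\<gamma> \<noteq> 0" using nz by (auto simp: Q_def R_def)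
      then show False
        using h skew[of "lineB (\<beta> * (\<gamma> * \<delta>), \<beta>)" "lineC (\<gamma>, \<delta>)"] lineB_lineC_skew_iff lines_distinct(3)
        by (auto simp: Q_def R_def)
    qed
  qed (auto simp: P_def Q_def R_def)
  ultimately show ?thesis by blast
qed

section \<open>Roots of unity and their exponents\<close>

text \<open>Integer exponents, so that quotients of roots become differences and equality becomes
  congruence modulo \<open>d\<close>.\<close>

definition zeta :: "nat \<Rightarrow> int \<Rightarrow> complex" where
  "zeta d k = cis (2 * pi * of_int k / of_nat d)"

lemma zeta_add: "zeta d (j + k) = zeta d j * zeta d k"
  by (simp add: zeta_def cis_mult distrib_left add_divide_distrib)

lemma zeta_diff: "zeta d (j - k) = zeta d j / zeta d k"
  by (simp add: zeta_def cis_divide right_diff_distrib diff_divide_distrib)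

lemma zeta_nonzero: "zeta d k \<noteq> 0"
  by (simp add: zeta_def)

lemma zeta_eq_1_iff:
  assumes "d > 0"
  shows "zeta d k = 1 \<longleftrightarrow> int d dvd k"
proof -
  have "zeta d k = 1 \<longleftrightarrow> (\<exists>n. 2 * pi * of_int k / of_nat d = of_int n * (2 * pi))"
    unfolding zeta_def by (rule cis_eq_1_iff)
  also have "\<dots> \<longleftrightarrow> (\<exists>n. real_of_int k = real_of_int (int d * n))"
    using assms by (simp add: field_simps)
  also have "\<dots> \<longleftrightarrow> int d dvd k"
    by (simp only: of_int_eq_iff dvd_def)
  finally show ?thesis .
qed

lemma zeta_eq_iff:
  assumes "d > 0"
  shows "zeta d j = zeta d k \<longleftrightarrow> j mod int d = k mod int d"
proof -
  have "zeta d j = zeta d k \<longleftrightarrow> zeta d (j - k) = 1"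
    by (simp add: zeta_diff zeta_nonzero)
  then show ?thesis
    by (simp add: zeta_eq_1_iff[OF assms] mod_eq_dvd_iff)
qed

lemma zeta_in_roots:
  assumes "d > 0"
  shows "zeta d k \<in> roots d 1"
proof -
  have "zeta d k ^ d = cis (real d * (2 * pi * of_int k / real d))"
    unfolding zeta_def by (rule Complex.DeMoivre)
  also have "\<dots> = cis (2 * pi * of_int k)" using assms by simp
  also have "\<dots> = 1" by (rule cis_multiple_2pi) simp
  finally show ?thesis by (simp add: roots_def)
qed

lemma finite_roots: "d > 0 \<Longrightarrow> finite (roots d e)"
  unfolding roots_def by blast

lemma card_roots: "d > 0 \<Longrightarrow> e \<noteq> 0 \<Longrightarrow> card (roots d e) = d"
  unfolding roots_def by (rule card_nth_roots)

section \<open>Upper bound: counting products and quotients\<close>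

lemma inj_fst_subset_roots:
  assumes "d > 0" "e \<noteq> 0" "P \<subseteq> roots d e \<times> roots d e" "inj_on fst P"
  shows "finite P" "card P \<le> d"
proof -
  have sub: "fst ` P \<subseteq> roots d e" using assms(3) by auto
  show "finite P"
    using finite_subset[OF sub finite_roots[OF assms(1)]] assms(4) by (simp add: finite_image_iff)
  show "card P \<le> d"
    using card_mono[OF finite_roots[OF assms(1)] sub] card_roots[OF assms(1,2)] card_image[OF assms(4)]
    by simp
qed

abbreviation prods :: "(complex \<times> complex) set \<Rightarrow> complex set" where
  "prods P \<equiv> (\<lambda>(\<alpha>, \<beta>). \<alpha> * \<beta>) ` P"

abbreviation quots :: "(complex \<times> complex) set \<Rightarrow> complex set" where
  "quots P \<equiv> (\<lambda>(\<alpha>, \<beta>). \<alpha> / \<beta>) ` P"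

text \<open>For \<open>e = -1\<close> the two signs cancel, so the values of all three families lie
  in the same set of \<open>d\<close> roots of 1.\<close>

lemma prods_quots_subset:
  assumes "P \<subseteq> roots d e \<times> roots d e" "e = 1 \<or> e = -1" "d > 0"
  shows "prods P \<subseteq> roots d 1" "quots P \<subseteq> roots d 1"
  using assms by (auto simp: roots_def power_mult_distrib power_divide)

lemma card_disjoint_le:
  assumes "d > 0" "U \<subseteq> roots d 1" "V \<subseteq> roots d 1" "U \<inter> V = {}"
  shows "card U + card V \<le> d"
proof -
  have "finite U" "finite V" using assms finite_roots[OF assms(1)] finite_subset by blast+
  then have "card U + card V = card (U \<union> V)" using assms(4) by (simp add: card_Un_disjoint)
  also have "\<dots> \<le> card (roots d 1)" using assms finite_roots by (intro card_mono) auto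
  finally show ?thesis using card_roots[OF assms(1)] by simp
qed

lemma image_pairs_disjointI:
  assumes "\<And>a b c d. (a, b) \<in> A \<Longrightarrow> (c, d) \<in> B \<Longrightarrow> f a b \<noteq> g c d"
  shows "(\<lambda>(a, b). f a b) ` A \<inter> (\<lambda>(a, b). g a b) ` B = {}"
  using assms by (fastforce simp del: not_iff)

text \<open>Each incidence condition between two families can be separated into a product or
  quotient from either side. It then says that two subsets of the \<open>d\<close> roots of 1 are
  disjoint.\<close>

lemma skew_params_card_constraints:
  assumes d: "d > 0" and PQR: "skew_params d P Q R"
  shows "card (prods P) + card (prods Q) \<le> d"
    "card (quots P) + card (quots R) \<le> d"
    "card (quots Q) + card (prods R) \<le> d"
proof -
  have sub: "P \<subseteq> roots d 1 \<times> roots d 1" "Q \<subseteq> roots d 1 \<times> roots d 1" "R \<subseteq> roots d (-1) \<times> roots d (-1)"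
    using PQR by (simp_all add: skew_params_def)
  have sub1: "prods P \<subseteq> roots d 1" "quots P \<subseteq> roots d 1" "prods Q \<subseteq> roots d 1"
    "quots Q \<subseteq> roots d 1" "prods R \<subseteq> roots d 1" "quots R \<subseteq> roots d 1"
    using prods_quots_subset[OF sub(1) _ d] prods_quots_subset[OF sub(2) _ d]
      prods_quots_subset[OF sub(3) _ d] by simp_all
  have nz: "z \<noteq> 0" if "z \<in> roots d 1 \<or> z \<in> roots d (-1)" for z
    using that d roots_nonzero[of z d 1] roots_nonzero[of z d "-1"] by auto
  have "\<alpha> * \<beta> \<noteq> \<gamma> * \<delta>" if "(\<alpha>, \<beta>) \<in> P" "(\<gamma>, \<delta>) \<in> Q" for \<alpha> \<beta> \<gamma> \<delta>
    using PQR that unfolding skew_params_def by fast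
  then have "prods P \<inter> prods Q = {}" by (rule image_pairs_disjointI)
  then show "card (prods P) + card (prods Q) \<le> d"
    by (intro card_disjoint_le d sub1)
  have "\<alpha> / \<beta> \<noteq> \<gamma> / \<delta>" if "(\<alpha>, \<beta>) \<in> P" "(\<gamma>, \<delta>) \<in> R" for \<alpha> \<beta> \<gamma> \<delta>
  proof -
    have "\<alpha> * \<delta> \<noteq> \<gamma> * \<beta>" using PQR that unfolding skew_params_def by fast
    moreover have "\<beta> \<noteq> 0" "\<delta> \<noteq> 0" using that sub nz by auto
    ultimately show ?thesis by (simp add: field_simps)
  qed
  then have "quots P \<inter> quots R = {}" by (rule image_pairs_disjointI)
  then show "card (quots P) + card (quots R) \<le> d"
    by (intro card_disjoint_le d sub1)
  have "\<alpha> / \<beta> \<noteq> \<gamma> * \<delta>" if "(\<alpha>, \<beta>) \<in> Q" "(\<gamma>, \<delta>) \<in> R" for \<alpha> \<beta> \<gamma> \<delta>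
  proof -
    have "\<alpha> \<noteq> \<beta> * (\<gamma> * \<delta>)" using PQR that unfolding skew_params_def by fast
    moreover have "\<beta> \<noteq> 0" using that sub nz by auto
    ultimately show ?thesis by (simp add: field_simps)
  qed
  then have "quots Q \<inter> prods R = {}" by (rule image_pairs_disjointI)
  then show "card (quots Q) + card (prods R) \<le> d"
    by (intro card_disjoint_le d sub1)
qed

text \<open>If \<open>x\<close> is taken \<open>n\<close> times and \<open>y\<close> the other
  \<open>d - n\<close> times, then \<open>x ^ n * y ^ (d - n) = 1\<close> gives
  \<open>(x / y) ^ n = 1\<close> with \<open>0 < n < d\<close>. Since also
  \<open>(x / y) ^ d = 1\<close> and \<open>n\<close> is coprime to the prime \<open>d\<close>, it
  follows that \<open>x = y\<close>.\<close>

lemma two_valued_prod_ne_1: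
  assumes d: "prime d" and fin: "finite P" and card: "card P = d"
    and f: "f ` P \<subseteq> roots d 1" and prod: "(\<Prod>p\<in>P. f p) = 1"
  shows "card (f ` P) \<noteq> 2"
proof
  assume "card (f ` P) = 2"
  then obtain x y where xy: "f ` P = {x, y}" "x \<noteq> y" by (auto simp: card_2_iff)
  have d0: "d > 0" using d prime_gt_0_nat by blast
  have xd: "x ^ d = 1" and yd: "y ^ d = 1" using f xy(1) by (auto simp: roots_def)
  then have y0: "y \<noteq> 0" using d0 by (auto simp: zero_power)
  define A where "A = {p \<in> P. f p = x}"
  define n where "n = card A"
  have fA: "finite A" "A \<subseteq> P" using fin by (auto simp: A_def)
  obtain p q where "p \<in> P" "f p = x" "q \<in> P" "f q = y"
    using xy(1) by (metis imageE insertI1 insertI2)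
  then have pq: "p \<in> A" "q \<in> P - A" using xy(2) by (auto simp: A_def)
  then have "A \<noteq> {}" by blast
  then have n0: "n > 0" using fA by (simp add: n_def card_gt_0_iff)
  have "A \<subset> P" using pq fA(2) by blast
  then have nd: "n < d" unfolding n_def card[symmetric] by (rule psubset_card_mono[OF fin])
  have "1 = (\<Prod>p\<in>A. f p) * (\<Prod>p\<in>P - A. f p)"
    using prod.subset_diff[OF fA(2) fin, of f] prod by (simp add: mult.commute)
  also have "(\<Prod>p\<in>A. f p) = x ^ n"
    by (simp add: A_def n_def)
  also have "(\<Prod>p\<in>P - A. f p) = (\<Prod>p\<in>P - A. y)"
    using xy(1) by (intro prod.cong) (auto simp: A_def)
  also have "\<dots> = y ^ (d - n)"
    using fA card by (simp add: card_Diff_subset n_def)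
  \<comment> \<open>Multiplication by \<open>y ^ n\<close> completes the exponent of
    \<open>y\<close> to \<open>d\<close>.\<close>
  finally have "1 * y ^ n = x ^ n * y ^ (d - n) * y ^ n" by metis
  also have "\<dots> = x ^ n * y ^ d"
    using nd by (simp add: mult.assoc flip: power_add)
  finally have "x ^ n = y ^ n" using yd by simp
  then have "(x / y) ^ n = 1" using y0 by (metis divide_self power_divide power_not_zero)
  have "\<not> d dvd n" using n0 nd by (simp add: nat_dvd_not_less)
  then have "coprime d n" using d by (simp add: prime_imp_coprime)
  then obtain i j where ij: "n * i = d * j + 1"
    using bezout_nat[of n d] n0 by (metis coprime_imp_gcd_eq_1 gcd.commute neq0_conv)
  have "1 = (x / y) ^ (n * i)" using \<open>(x / y) ^ n = 1\<close> by (simp add: power_mult)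
  also have "\<dots> = ((x / y) ^ d) ^ j * (x / y)" by (simp add: ij power_add power_mult)
  also have "\<dots> = x / y" using xd yd by (simp add: power_divide)
  finally show False using xy(2) y0 by (simp add: field_simps)
qed

text \<open>For odd \<open>d\<close> the negative of a root of \<open>e\<close> is a root of
  \<open>-e\<close>, so two roots with equal squares cannot be opposite.\<close>

lemma power2_inj_on_roots:
  assumes "odd d" "e \<noteq> 0"
  shows "inj_on (\<lambda>z. z\<^sup>2) (roots d e)"
proof (rule inj_onI)
  fix x y assume xy: "x \<in> roots d e" "y \<in> roots d e" "x\<^sup>2 = y\<^sup>2"
  have "x \<noteq> - y"
  proof
    assume "x = - y"
    then have "e = - e" using xy assms(1) by (auto simp: roots_def)
    then show False using assms(2) by simp
  qed
  then show "x = y" using xy(3) by (auto simp: power2_eq_iff)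
qed

text \<open>Inversion permutes the roots, so their product equals its own inverse.\<close>

lemma prod_roots_square:
  assumes "d > 0" "e = 1 \<or> e = -1"
  shows "\<Prod>(roots d e) * \<Prod>(roots d e) = 1"
proof -
  have nz: "z \<noteq> 0" if "z \<in> roots d e" for z using that assms roots_nonzero by fastforce
  have "bij_betw inverse (roots d e) (roots d e)"
    by (rule bij_betwI[of _ _ _ inverse]) (use assms(2) in \<open>auto simp: roots_def power_inverse\<close>)
  then have "\<Prod>(roots d e) = (\<Prod>z\<in>roots d e. inverse z)"
    using prod.reindex_bij_betw[of inverse "roots d e" "roots d e" "\<lambda>z. z"] by simp
  then have "\<Prod>(roots d e) * \<Prod>(roots d e) = (\<Prod>z\<in>roots d e. inverse z * z)"
    by (simp add: prod.distrib)
  also have "\<dots> = 1" using nz by (intro prod.neutral) simp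
  finally show ?thesis .
qed

text \<open>A full set of parameters is a permutation of the \<open>d\<close>-th roots, so its products and its
  quotients multiply to 1. For \<open>d\<close> prime they can therefore not take exactly two values.\<close>

lemma full_params_cards:
  assumes d: "prime d" "odd d" and e: "e = 1 \<or> e = -1" and P: "P \<subseteq> roots d e \<times> roots d e"
    and inj: "inj_on fst P" "inj_on snd P" and card: "card P = d"
  shows "card (prods P) \<ge> 3 \<or> card (quots P) = d"
    and "card (quots P) \<ge> 3 \<or> card (prods P) = d"
proof -
  have d0: "d > 0" using d(1) prime_gt_0_nat by blast
  have e0: "e \<noteq> 0" using e by auto
  have fin: "finite P" using inj_fst_subset_roots[OF d0 e0 P inj(1)] by simp
  have ne: "P \<noteq> {}" using card d0 by auto
  have img: "fst ` P = roots d e" "snd ` P = roots d e"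
    by (rule card_subset_eq[OF finite_roots[OF d0]];
        use P card card_roots[OF d0 e0] card_image[OF inj(1)] card_image[OF inj(2)] in auto)+
  have fst_prod: "(\<Prod>p\<in>P. fst p) = \<Prod>(roots d e)"
    using prod.reindex[OF inj(1), of "\<lambda>z. z"] img by simp
  have snd_prod: "(\<Prod>p\<in>P. snd p) = \<Prod>(roots d e)"
    using prod.reindex[OF inj(2), of "\<lambda>z. z"] img by simp
  have sq: "\<Prod>(roots d e) * \<Prod>(roots d e) = 1" by (rule prod_roots_square[OF d0 e])
  note sub = prods_quots_subset[OF P e d0]
  have "(\<Prod>p\<in>P. case p of (\<alpha>, \<beta>) \<Rightarrow> \<alpha> * \<beta>) = 1"
    using sq by (simp add: split_beta prod.distrib fst_prod snd_prod)
  from two_valued_prod_ne_1[OF d(1) fin card sub(1) this] have prods2: "card (prods P) \<noteq> 2" .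
  have "(\<Prod>p\<in>P. case p of (\<alpha>, \<beta>) \<Rightarrow> \<alpha> / \<beta>) = 1"
    using sq by (auto simp: split_beta prod_dividef fst_prod snd_prod)
  from two_valued_prod_ne_1[OF d(1) fin card sub(2) this] have quots2: "card (quots P) \<noteq> 2" .
  have pos: "card (prods P) > 0" "card (quots P) > 0"
    using fin ne by (simp_all add: card_gt_0_iff)
  have nz: "z \<noteq> 0" if "z \<in> roots d e" for z using roots_nonzero[OF that d0 e0] .
  \<comment> \<open>If the product is constantly \<open>x\<close>, the quotient is
    \<alpha>\<open>^2 / x\<close>, and squaring is injective on the roots. The case of a constant
    quotient is dual.\<close>
  have "card (quots P) = d" if one: "card (prods P) = 1"
  proof -
    obtain x where "prods P = {x}" using one by (auto simp: card_1_singleton_iff)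
    then have x: "\<alpha> * \<beta> = x" if "(\<alpha>, \<beta>) \<in> P" for \<alpha> \<beta> using that by auto
    have "inj_on (\<lambda>(\<alpha>, \<beta>). \<alpha> / \<beta>) P"
    proof (rule inj_onI, clarify)
      fix a b a' b' assume h: "(a, b) \<in> P" "(a', b') \<in> P" "a / b = a' / b'"
      have r: "a \<in> roots d e" "b \<in> roots d e" "a' \<in> roots d e" "b' \<in> roots d e"
        using h P by auto
      have "a * b = a' * b'" "a * b' = a' * b"
        using x h r(2,4)[THEN nz] by (auto simp: field_simps)
      then have "a\<^sup>2 * (b * b') = a'\<^sup>2 * (b * b')" unfolding power2_eq_square by algebra
      then have "a\<^sup>2 = a'\<^sup>2" using r nz by simp
      then have "a = a'" using inj_onD[OF power2_inj_on_roots[OF d(2) e0]] r by blast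
      then show "a = a' \<and> b = b'" using inj_onD[OF inj(1) _ h(1,2)] by simp
    qed
    then show ?thesis using card by (simp add: card_image)
  qed
  then show "card (prods P) \<ge> 3 \<or> card (quots P) = d" using prods2 pos by linarith
  have "card (prods P) = d" if one: "card (quots P) = 1"
  proof -
    obtain x where "quots P = {x}" using one by (auto simp: card_1_singleton_iff)
    then have x: "\<alpha> / \<beta> = x" if "(\<alpha>, \<beta>) \<in> P" for \<alpha> \<beta> using that by auto
    have "inj_on (\<lambda>(\<alpha>, \<beta>). \<alpha> * \<beta>) P"
    proof (rule inj_onI, clarify)
      fix a b a' b' assume h: "(a, b) \<in> P" "(a', b') \<in> P" "a * b = a' * b'"
      have r: "a \<in> roots d e" "b \<in> roots d e" "a' \<in> roots d e" "b' \<in> roots d e"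
        using h P by auto
      have "a / b = a' / b'" using x h by metis
      then have "a * b' = a' * b"
        using r(2,4)[THEN nz] by (auto simp: field_simps)
      then have "a\<^sup>2 * (b * b') = a'\<^sup>2 * (b * b')"
        using h(3) unfolding power2_eq_square by algebra
      then have "a\<^sup>2 = a'\<^sup>2" using r nz by simp
      then have "a = a'" using inj_onD[OF power2_inj_on_roots[OF d(2) e0]] r by blast
      then show "a = a' \<and> b = b'" using inj_onD[OF inj(1) _ h(1,2)] by simp
    qed
    then show ?thesis using card by (simp add: card_image)
  qed
  then show "card (quots P) \<ge> 3 \<or> card (prods P) = d" using quots2 pos by linarith
qed

text \<open>For \<open>d = 3\<close> a full family would have some value set of size 3, leaving no
  room for its partner, so a third family forces all sizes down to 2. For \<open>d = 5\<close> a
  total above 13 needs two full families, whose constraint fails.\<close>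

lemma skew_params_card_le:
  assumes d: "d > 0" and PQR: "skew_params d P Q R"
  shows "card P + card Q + card R \<le> (if d = 3 then 6 else if d = 5 then 13 else 3 * d)"
proof (rule ccontr)
  assume gt: "\<not> ?thesis"
  have P: "P \<subseteq> roots d 1 \<times> roots d 1" "inj_on fst P" "inj_on snd P"
    and Q: "Q \<subseteq> roots d 1 \<times> roots d 1" "inj_on fst Q" "inj_on snd Q"
    and R: "R \<subseteq> roots d (-1) \<times> roots d (-1)" "inj_on fst R" "inj_on snd R"
    using PQR by (simp_all add: skew_params_def)
  have le: "card P \<le> d" "card Q \<le> d" "card R \<le> d"
    using inj_fst_subset_roots[OF d _ P(1,2)] inj_fst_subset_roots[OF d _ Q(1,2)]
      inj_fst_subset_roots[OF d _ R(1,2)] by simp_all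
  \<comment> \<open>A total above the bound leaves no family empty, so every value set is nonempty
    and none can fill all \<open>d\<close> roots.\<close>
  then have d35: "d = 3 \<or> d = 5" and pos: "card P \<noteq> 0" "card Q \<noteq> 0" "card R \<noteq> 0"
    using gt by (auto split: if_splits)
  then have "card (prods X) > 0" "card (quots X) > 0" if "X \<in> {P, Q, R}" for X
    using that by (auto simp: card_gt_0_iff)
  then have "card (prods P) > 0" "card (quots P) > 0" "card (prods Q) > 0"
    "card (quots Q) > 0" "card (prods R) > 0" "card (quots R) > 0" by simp_all
  note bounds = this skew_params_card_constraints[OF d PQR]
  show False
    using d35
  proof
    assume [simp]: "d = 3"
    have "card P \<noteq> 3" "card Q \<noteq> 3" "card R \<noteq> 3"
      using full_params_cards(1)[of 3 1 P] full_params_cards(1)[of 3 1 Q]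
        full_params_cards(1)[of 3 "-1" R] P Q R bounds by auto
    then show False using le gt by simp
  next
    assume [simp]: "d = 5"
    have "3 \<le> card (prods P) \<and> 3 \<le> card (quots P)" if "card P = 5"
      using full_params_cards[of 5 1 P] that P bounds by auto
    moreover have "3 \<le> card (prods Q) \<and> 3 \<le> card (quots Q)" if "card Q = 5"
      using full_params_cards[of 5 1 Q] that Q bounds by auto
    moreover have "3 \<le> card (prods R) \<and> 3 \<le> card (quots R)" if "card R = 5"
      using full_params_cards[of 5 "-1" R] that R bounds by auto
    \<comment> \<open>Any two families share one constraint, and two full ones would need
      \<open>3 + 3 \<le> 5\<close>.\<close>
    ultimately have "\<not> (card P = 5 \<and> card Q = 5)" "\<not> (card P = 5 \<and> card R = 5)"
      "\<not> (card Q = 5 \<and> card R = 5)"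
      using bounds(7-9) by auto
    then show False using le gt by auto
  qed
qed

lemma skew_family_card_le:
  assumes d: "d \<ge> 3" and S: "skew_family d S"
  shows "finite S \<and> card S \<le> (if d = 3 then 6 else if d = 5 then 13 else 3 * d)"
proof -
  obtain P Q R where PQR: "skew_params d P Q R" and S_eq: "S = lineA ` P \<union> lineB ` Q \<union> lineC ` R"
    using skew_params_of_skew_family[OF d S] by blast
  have d0: "d > 0" using d by simp
  have fin: "finite P" "finite Q" "finite R"
    using PQR inj_fst_subset_roots(1)[OF d0, of 1] inj_fst_subset_roots(1)[OF d0, of "-1"]
    by (simp_all add: skew_params_def)
  have "card S \<le> card (lineA ` P \<union> lineB ` Q) + card (lineC ` R)"
    unfolding S_eq by (rule card_Un_le)
  also have "\<dots> \<le> card (lineA ` P) + card (lineB ` Q) + card (lineC ` R)"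
    by (intro add_right_mono card_Un_le)
  also have "\<dots> \<le> card P + card Q + card R"
    using fin by (intro add_mono card_image_le)
  finally show ?thesis
    using skew_params_card_le[OF d0 PQR] fin S_eq by auto
qed

section \<open>Lower bound: families from exponents modulo d\<close>

definition inj_mod :: "nat \<Rightarrow> ('a \<Rightarrow> int) \<Rightarrow> 'a set \<Rightarrow> bool" where
  "inj_mod d f A \<longleftrightarrow> inj_on (\<lambda>x. f x mod int d) A"

text \<open>The roots of -1 are written \<open>\<kappa> * zeta d k\<close>; for even \<open>d\<close> one cannot take \<open>\<kappa> = -1\<close>, and
  the shift \<open>s\<close> records the discrepancy.\<close>

lemma skew_family_of_exponents:
  fixes A B C :: "(int \<times> int) set"
  assumes d: "d > 0" and \<kappa>: "\<kappa> ^ d = -1" "\<kappa> * \<kappa> = zeta d s"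
    and fin: "finite A" "finite B" "finite C"
    and inj: "inj_mod d fst A" "inj_mod d snd A" "inj_mod d fst B" "inj_mod d snd B"
      "inj_mod d fst C" "inj_mod d snd C"
    and AB: "\<forall>p\<in>A. \<forall>q\<in>B. (fst p + snd p) mod int d \<noteq> (fst q + snd q) mod int d"
    and AC: "\<forall>p\<in>A. \<forall>q\<in>C. (fst p - snd p) mod int d \<noteq> (fst q - snd q) mod int d"
    and BC: "\<forall>p\<in>B. \<forall>q\<in>C. (fst p - snd p) mod int d \<noteq> (fst q + snd q + s) mod int d"
  shows "\<exists>S. skew_family d S \<and> finite S \<and> card S = card A + card B + card C"
proof -
  define P where "P = (\<lambda>p. (zeta d (fst p), zeta d (snd p))) ` A"
  define Q where "Q = (\<lambda>p. (zeta d (fst p), zeta d (snd p))) ` B"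
  define R where "R = (\<lambda>p. (\<kappa> * zeta d (fst p), \<kappa> * zeta d (snd p))) ` C"
  have \<kappa>0: "\<kappa> \<noteq> 0" using \<kappa>(2) zeta_nonzero by auto
  have z: "zeta d i = zeta d j \<longleftrightarrow> i mod int d = j mod int d" for i j
    by (rule zeta_eq_iff[OF d])
  have zd: "zeta d i ^ d = 1" for i using zeta_in_roots[OF d, of i] by (simp add: roots_def)
  have eq: "p = q" if "inj_mod d f X" "p \<in> X" "q \<in> X" "f p mod int d = f q mod int d"
    for f and p q :: "int \<times> int" and X
    using that by (auto simp: inj_mod_def dest: inj_onD)
  have cards: "card P = card A" "card Q = card B" "card R = card C"
    unfolding P_def Q_def R_def
    by (rule card_image; rule inj_onI; use \<kappa>0 in \<open>simp add: z\<close>; blast intro: eq[OF inj(1)] eq[OF inj(3)] eq[OF inj(5)])+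
  have "skew_params d P Q R"
    unfolding skew_params_def
  proof (intro conjI)
    show "inj_on fst P" "inj_on snd P" "inj_on fst Q" "inj_on snd Q"
      unfolding P_def Q_def
      by (rule inj_onI; elim imageE; simp add: z;
          use eq[OF inj(1)] eq[OF inj(2)] eq[OF inj(3)] eq[OF inj(4)] in blast)+
    show "inj_on fst R" "inj_on snd R"
      unfolding R_def
      by (rule inj_onI; elim imageE; use \<kappa>0 in \<open>simp add: z\<close>;
          use eq[OF inj(5)] eq[OF inj(6)] in blast)+
    show "P \<subseteq> roots d 1 \<times> roots d 1" "Q \<subseteq> roots d 1 \<times> roots d 1" "R \<subseteq> roots d (-1) \<times> roots d (-1)"
      by (auto simp: P_def Q_def R_def roots_def power_mult_distrib zd \<kappa>(1))
    show "\<forall>(\<alpha>, \<beta>)\<in>P. \<forall>(\<gamma>, \<delta>)\<in>Q. \<alpha> * \<beta> \<noteq> \<gamma> * \<delta>"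
      using AB by (simp add: P_def Q_def z flip: zeta_add)
    show "\<forall>(\<alpha>, \<beta>)\<in>P. \<forall>(\<gamma>, \<delta>)\<in>R. \<alpha> * \<delta> \<noteq> \<gamma> * \<beta>"
    proof -
      have "zeta d (fst p) * (\<kappa> * zeta d (snd q)) \<noteq> \<kappa> * zeta d (fst q) * zeta d (snd p)"
        if "p \<in> A" "q \<in> C" for p q
      proof -
        have "zeta d (fst p - snd p) \<noteq> zeta d (fst q - snd q)" using AC that by (simp add: z)
        then have "zeta d (fst p) * zeta d (snd q) \<noteq> zeta d (fst q) * zeta d (snd p)"
          by (simp add: zeta_diff zeta_nonzero field_simps)
        then show ?thesis using \<kappa>0 by (simp add: mult_ac)
      qed
      then show ?thesis by (simp add: P_def R_def)
    qed
    show "\<forall>(\<alpha>, \<beta>)\<in>Q. \<forall>(\<gamma>, \<delta>)\<in>R. \<alpha> \<noteq> \<beta> * (\<gamma> * \<delta>)"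
    proof -
      have "zeta d (fst p) \<noteq> zeta d (snd p) * (\<kappa> * zeta d (fst q) * (\<kappa> * zeta d (snd q)))"
        if "p \<in> B" "q \<in> C" for p q
      proof -
        have "zeta d (fst p - snd p) \<noteq> zeta d (fst q + snd q + s)" using BC that by (simp add: z)
        then have "zeta d (fst p) \<noteq> zeta d (snd p) * (zeta d (fst q) * zeta d (snd q) * (\<kappa> * \<kappa>))"
          by (simp add: zeta_diff zeta_add zeta_nonzero \<kappa>(2) field_simps)
        then show ?thesis by (simp add: mult_ac)
      qed
      then show ?thesis by (simp add: Q_def R_def)
    qed
  qed
  moreover have "finite P" "finite Q" "finite R" using fin by (simp_all add: P_def Q_def R_def)
  ultimately show ?thesis
    using skew_family_of_skew_params[OF d] cards by metis
qed

text \<open>The case of three full families, each parametrised by the residues. Congruences are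
  restated as divisibility, which parity and size arguments can refute.\<close>

lemma skew_family_of_maps:
  fixes f f' g g' h h' :: "int \<Rightarrow> int"
  assumes d: "d > 0" and \<kappa>: "\<kappa> ^ d = -1" "\<kappa> * \<kappa> = zeta d s" and I: "I = {0..<int d}"
    and inj: "inj_mod d f I" "inj_mod d f' I" "inj_mod d g I" "inj_mod d g' I"
      "inj_mod d h I" "inj_mod d h' I"
    and AB: "\<And>a b. a \<in> I \<Longrightarrow> b \<in> I \<Longrightarrow> \<not> int d dvd (f a + f' a) - (g b + g' b)"
    and AC: "\<And>a b. a \<in> I \<Longrightarrow> b \<in> I \<Longrightarrow> \<not> int d dvd (f a - f' a) - (h b - h' b)"
    and BC: "\<And>a b. a \<in> I \<Longrightarrow> b \<in> I \<Longrightarrow> \<not> int d dvd (g a - g' a) - (h b + h' b + s)"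
  shows "\<exists>S. skew_family d S \<and> finite S \<and> card S = 3 * d"
proof -
  have pair: "card ((\<lambda>a. (u a, v a)) ` I) = d" "inj_mod d fst ((\<lambda>a. (u a, v a)) ` I)"
    "inj_mod d snd ((\<lambda>a. (u a, v a)) ` I)"
    if uv: "inj_mod d u I" "inj_mod d v I" for u v :: "int \<Rightarrow> int"
  proof -
    have "inj_on (\<lambda>a. (u a, v a)) I" using uv(1) by (auto simp: inj_mod_def inj_on_def)
    then show "card ((\<lambda>a. (u a, v a)) ` I) = d" by (simp add: card_image I)
    show "inj_mod d fst ((\<lambda>a. (u a, v a)) ` I)" "inj_mod d snd ((\<lambda>a. (u a, v a)) ` I)"
      using uv unfolding inj_mod_def inj_on_def by auto
  qed
  note p = pair[OF inj(1,2)] pair[OF inj(3,4)] pair[OF inj(5,6)]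
  have fin: "finite I" by (simp add: I)
  have "\<exists>S. skew_family d S \<and> finite S \<and> card S = card ((\<lambda>a. (f a, f' a)) ` I)
      + card ((\<lambda>a. (g a, g' a)) ` I) + card ((\<lambda>a. (h a, h' a)) ` I)"
    by (rule skew_family_of_exponents[OF d \<kappa> _ _ _ p(2,3,5,6,8,9)])
       (use AB AC BC fin in \<open>auto simp: mod_eq_dvd_iff\<close>)
  moreover have "card ((\<lambda>a. (f a, f' a)) ` I) + card ((\<lambda>a. (g a, g' a)) ` I)
      + card ((\<lambda>a. (h a, h' a)) ` I) = 3 * d"
    using p(1,4,7) by simp
  ultimately show ?thesis by simp
qed

section \<open>Constructions for even and for large odd degree\<close>

lemma dvd_cases:
  fixes d x :: int
  assumes "d dvd x" "\<bar>x\<bar> < 3 * d"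
  shows "x = 0 \<or> x = d \<or> x = - d \<or> x = 2 * d \<or> x = - 2 * d"
proof -
  obtain k where k: "x = d * k" using assms(1) by blast
  have d: "d > 0" using assms(2) by linarith
  have "\<bar>k\<bar> < 3" using assms(2) d by (simp add: k abs_mult)
  then have "k = 0 \<or> k = 1 \<or> k = -1 \<or> k = 2 \<or> k = -2" by linarith
  then show ?thesis by (auto simp: k)
qed

lemma inj_mod_of_permutation:
  assumes "\<sigma> \<in> {0..<int d} \<rightarrow> {0..<int d}" "inj_on \<sigma> {0..<int d}"
  shows "inj_mod d (\<lambda>a. \<sigma> a + c) {0..<int d}"
  unfolding inj_mod_def
proof (rule inj_onI)
  fix a b assume ab: "a \<in> {0..<int d}" "b \<in> {0..<int d}" "(\<sigma> a + c) mod int d = (\<sigma> b + c) mod int d"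
  have "int d dvd \<sigma> a - \<sigma> b" using ab(3) by (simp add: mod_eq_dvd_iff)
  moreover have "\<sigma> a \<in> {0..<int d}" "\<sigma> b \<in> {0..<int d}" using ab assms(1) by auto
  ultimately have "\<sigma> a = \<sigma> b" using dvd_cases[of "int d" "\<sigma> a - \<sigma> b"] by auto
  then show "a = b" using assms(2) ab by (auto dest: inj_onD)
qed

text \<open>The sums of the first two families are 0 and 1; the differences of the first are even
  and those of the third are -1; the differences \<open>2 * a - 1\<close> of the second are odd and
  the shifted sums \<open>2 * b + 2\<close> of the third even. Every pair to be separated thus
  differs by an odd number, which the even \<open>d\<close> cannot divide.\<close>

lemma exists_skew_family_even:
  assumes d: "d > 0" "even d"
  shows "\<exists>S. skew_family d S \<and> finite S \<and> card S = 3 * d"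
proof (rule skew_family_of_maps[where \<kappa> = "cis (pi / d)" and s = 1 and f = "\<lambda>a. a" and f' = "\<lambda>a. - a"
      and g = "\<lambda>a. a" and g' = "\<lambda>a. 1 - a" and h = "\<lambda>a. a" and h' = "\<lambda>a. a + 1"])
  have "cis (pi / d) ^ d = cis (real d * (pi / d))" by (rule Complex.DeMoivre)
  then show "cis (pi / d) ^ d = - 1" using d by simp
  show "cis (pi / d) * cis (pi / d) = zeta d 1"
    by (simp add: zeta_def cis_mult)
  have id: "(\<lambda>a. a) \<in> {0..<int d} \<rightarrow> {0..<int d}" "inj_on (\<lambda>a. a) {0..<int d}" by auto
  show "inj_mod d (\<lambda>a. a) {0..<int d}" using inj_mod_of_permutation[OF id, of 0] by simp
  show "inj_mod d (\<lambda>a. a) {0..<int d}" using inj_mod_of_permutation[OF id, of 0] by simp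
  show "inj_mod d (\<lambda>a. a) {0..<int d}" using inj_mod_of_permutation[OF id, of 0] by simp
  show "inj_mod d (\<lambda>a. a + 1) {0..<int d}" using inj_mod_of_permutation[OF id, of 1] by simp
  have neg: "inj_mod d (\<lambda>a. c - a) {0..<int d}" for c
    unfolding inj_mod_def
  proof (rule inj_onI)
    fix a b assume "a \<in> {0..<int d}" "b \<in> {0..<int d}" "(c - a) mod int d = (c - b) mod int d"
    then show "a = b" using dvd_cases[of "int d" "b - a"] by (auto simp: mod_eq_dvd_iff)
  qed
  show "inj_mod d (\<lambda>a. - a) {0..<int d}" using neg[of 0] by simp
  show "inj_mod d (\<lambda>a. 1 - a) {0..<int d}" by (rule neg)
  have nd: "\<not> int d dvd x" if "odd x" for x :: int
    using that d(2) by (meson dvd_trans even_of_nat)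
  show "\<not> int d dvd (a + - a) - (b + (1 - b))" "\<not> int d dvd (a - - a) - (b - (b + 1))"
    "\<not> int d dvd (a - (1 - a)) - (b + (b + 1) + 1)" for a b
    by (rule nd; simp)+
qed (use d in auto)

text \<open>The set \<open>Y\<close> in the proof consists of odd representatives modulo \<open>d\<close> of the sums \<open>a + \<sigma> a\<close>.
  The fixed points of \<open>\<sigma>\<close> are placed so that twice a fixed point is again the sum of a swapped
  pair; for \<open>d = 4 * m + 1\<close> this takes three of them.\<close>

lemma exists_adjacent_swaps:
  fixes d :: int
  assumes d: "d \<ge> 9" "odd d"
  obtains \<sigma> :: "int \<Rightarrow> int"
  where "\<sigma> \<in> {0..<d} \<rightarrow> {0..<d}" "inj_on \<sigma> {0..<d}"
    "\<And>a. a \<in> {0..<d} \<Longrightarrow> \<bar>a - \<sigma> a\<bar> \<le> 1"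
    "\<And>a b. a \<in> {0..<d} \<Longrightarrow> b \<in> {0..<d} \<Longrightarrow> \<not> d dvd (a + \<sigma> a) - (b + \<sigma> b + 2)"
proof -
  have no_collision: "\<not> d dvd s - (t + 2)"
    if Y: "\<forall>y\<in>Y. odd y \<and> 1 \<le> y \<and> y \<le> 2 * d - 2" "\<forall>y\<in>Y. y + 2 \<notin> Y"
      and s: "s \<in> Y \<or> s - d \<in> Y \<or> s + d \<in> Y" and t: "t \<in> Y \<or> t - d \<in> Y \<or> t + d \<in> Y"
    for s t Y
  proof
    assume st: "d dvd s - (t + 2)"
    obtain y where y: "y \<in> Y" "d dvd s - y"
    proof -
      have "d dvd s - s" "d dvd s - (s - d)" "d dvd s - (s + d)" by simp_all
      then show thesis using s that by blast
    qed
    obtain z where z: "z \<in> Y" "d dvd t - z"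
    proof -
      have "d dvd t - t" "d dvd t - (t - d)" "d dvd t - (t + d)" by simp_all
      then show thesis using t that by blast
    qed
    have "d dvd (s - (t + 2)) - (s - y) + (t - z)" by (rule dvd_add[OF dvd_diff[OF st y(2)] z(2)])
    moreover have "(s - (t + 2)) - (s - y) + (t - z) = y - (z + 2)" by simp
    ultimately have dvd: "d dvd y - (z + 2)" by metis
    have yz: "odd y" "odd z" "1 \<le> y" "y \<le> 2 * d - 2" "1 \<le> z" "z \<le> 2 * d - 2"
      using Y(1) y z by auto
    moreover have "y \<noteq> z + 2" using Y(2) y z by auto
    moreover have "\<bar>y - (z + 2)\<bar> < 3 * d" using yz d(1) by linarith
    \<comment> \<open>The gap condition on \<open>Y\<close> excludes 0 and the range of
      \<open>Y\<close> excludes \<open>2 * d\<close> and \<open>- 2 * d\<close>. What remains is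
      odd, whereas a difference of odd numbers is even.\<close>
    ultimately have "y - (z + 2) = d \<or> y - (z + 2) = - d"
      using dvd_cases[OF dvd] by linarith
    then show False using yz(1,2) d(2) by presburger
  qed
  have "d = 4 * (d div 4) + 3 \<or> d = 4 * (d div 4) + 1"
    using d(2) by presburger
  then consider m where "d = 4 * m + 3" | m where "d = 4 * m + 1" by blast
  then show thesis
  proof cases
    case (1 m)
    \<comment> \<open>Swaps \<open>2 * j\<close> with \<open>2 * j + 1\<close> and fixes
      \<open>d - 1\<close>. All sums are then 1 modulo 4 after reduction by \<open>d\<close> where
      necessary, so no two of them differ by 2.\<close>
    define \<sigma> where "\<sigma> a = (if a = d - 1 then a else if even a then a + 1 else a - 1)" for a :: int
    have rng: "\<sigma> a \<in> {0..<d}" if "a \<in> {0..<d}" for a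
      using that d unfolding \<sigma>_def by (auto; presburger)
    have invol: "\<sigma> (\<sigma> a) = a" if "a \<in> {0..<d}" for a
      using that d unfolding \<sigma>_def by (auto; presburger)
    define Y where "Y = {y. y mod 4 = 1 \<and> 1 \<le> y \<and> y \<le> 2 * d - 5}"
    have sum: "a + \<sigma> a \<in> Y \<or> a + \<sigma> a - d \<in> Y" if "a \<in> {0..<d}" for a
    proof (cases "a = d - 1")
      case True
      then have "a + \<sigma> a - d = 4 * m + 1" by (simp add: \<sigma>_def 1)
      then show ?thesis using 1 d by (auto simp: Y_def)
    next
      case False
      then show ?thesis using that d by (auto simp: \<sigma>_def Y_def; presburger)
    qed
    have Y: "\<forall>y\<in>Y. odd y \<and> 1 \<le> y \<and> y \<le> 2 * d - 2" "\<forall>y\<in>Y. y + 2 \<notin> Y"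
      unfolding Y_def by (auto; presburger)+
    show thesis
    proof
      show "\<sigma> \<in> {0..<d} \<rightarrow> {0..<d}" using rng by blast
      show "inj_on \<sigma> {0..<d}" using invol by (metis inj_onI)
      show "\<bar>a - \<sigma> a\<bar> \<le> 1" for a by (simp add: \<sigma>_def)
      show "\<not> d dvd (a + \<sigma> a) - (b + \<sigma> b + 2)" if "a \<in> {0..<d}" "b \<in> {0..<d}" for a b
        using no_collision[OF Y] sum[OF that(1)] sum[OF that(2)] by blast
    qed
  next
    case (2 m)
    have m: "m \<ge> 2" using 2 d by simp
    \<comment> \<open>The swapped pairs are \<open>(1, 2)\<close>, then \<open>(4, 5)\<close> to
      \<open>(2 * m, 2 * m + 1)\<close>, then \<open>(2 * m + 3, 2 * m + 4)\<close> to
      \<open>(4 * m - 1, 4 * m)\<close>. Modulo \<open>d\<close>, the doubled fixed points 0, 3 and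
      \<open>2 * m + 2\<close> are \<open>4 * m + 1\<close>, \<open>4 * m + 7\<close> and 3.\<close>
    define \<sigma> where "\<sigma> a = (if a = 0 \<or> a = 3 \<or> a = 2 * m + 2 then a
      else if odd a \<longleftrightarrow> a < 3 \<or> a > 2 * m + 2 then a + 1 else a - 1)" for a :: int
    have rng: "\<sigma> a \<in> {0..<d}" if "a \<in> {0..<d}" for a
      using that m unfolding \<sigma>_def 2 by (auto; presburger)
    have low: "\<sigma> 0 = 0" "\<sigma> 1 = 2" "\<sigma> 2 = 1" "\<sigma> 3 = 3" "\<sigma> (2 * m + 2) = 2 * m + 2"
      using m by (simp_all add: \<sigma>_def)
    have mid: "\<sigma> a = (if even a then a + 1 else a - 1)" if "4 \<le> a" "a \<le> 2 * m + 1" for a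
      using that by (auto simp: \<sigma>_def)
    have up: "\<sigma> a = (if odd a then a + 1 else a - 1)" if "2 * m + 3 \<le> a" for a
      using that m by (auto simp: \<sigma>_def)
    have cases: "a = 0 \<or> a = 3 \<or> a = 2 * m + 2 \<or> a = 1 \<or> a = 2
        \<or> 4 \<le> a \<and> a \<le> 2 * m + 1 \<or> 2 * m + 3 \<le> a \<and> a \<le> 4 * m" if "a \<in> {0..<d}" for a
      using that 2 by force
    have invol: "\<sigma> (\<sigma> a) = a" if a: "a \<in> {0..<d}" for a
    proof -
      consider "a \<in> {0, 1, 2, 3, 2 * m + 2}" | "4 \<le> a" "a \<le> 2 * m + 1" | "2 * m + 3 \<le> a"
        using cases[OF a] by blast
      then show ?thesis
      proof cases
        case 1
        then show ?thesis using low by auto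
      next
        case 2
        have "4 \<le> \<sigma> a" "\<sigma> a \<le> 2 * m + 1" using mid[OF 2] 2 by presburger+
        from mid[OF this] show ?thesis using mid[OF 2] by simp
      next
        case 3
        have "2 * m + 3 \<le> \<sigma> a" using up[OF 3] 3 by presburger
        from up[OF this] show ?thesis using up[OF 3] by simp
      qed
    qed
    \<comment> \<open>Numbers that differ by 2 would lie in different classes modulo 4; the gaps
      from 3 to 9 and from \<open>4 * m + 1\<close> to \<open>4 * m + 7\<close> prevent
      this.\<close>
    define Y where "Y = {y. y = 3 \<or> y mod 4 = 1 \<and> 9 \<le> y \<and> y \<le> 4 * m + 1
        \<or> y mod 4 = 3 \<and> 4 * m + 7 \<le> y \<and> y \<le> 8 * m - 1}"
    have sum: "a + \<sigma> a \<in> Y \<or> a + \<sigma> a - d \<in> Y \<or> a + \<sigma> a + d \<in> Y" if a: "a \<in> {0..<d}" for a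
    proof -
      consider "a = 0" | "a = 3" | "a = 2 * m + 2" | "a = 1 \<or> a = 2"
        | "4 \<le> a" "a \<le> 2 * m + 1" | "2 * m + 3 \<le> a" "a \<le> 4 * m"
        using cases[OF a] by blast
      then show ?thesis
      proof cases
        case 1
        have "a + \<sigma> a + d = 4 * m + 1" by (simp add: \<sigma>_def 1 2)
        then show ?thesis using m by (auto simp: Y_def)
      next
        case 2
        have "a + \<sigma> a + d = 4 * (m + 1) + 3" by (simp add: \<sigma>_def 2 \<open>d = 4 * m + 1\<close>)
        then show ?thesis using m by (auto simp: Y_def)
      next
        case 3
        have "a + \<sigma> a - d = 3" by (simp add: \<sigma>_def 3 \<open>d = 4 * m + 1\<close>)
        then show ?thesis by (auto simp: Y_def)
      next
        case 4
        then have "a + \<sigma> a = 3" using low by auto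
        then show ?thesis by (auto simp: Y_def)
      next
        case 5
        have "(a + \<sigma> a) mod 4 = 1 \<and> 9 \<le> a + \<sigma> a \<and> a + \<sigma> a \<le> 4 * m + 1"
          using mid[OF 5] 5 by presburger
        then show ?thesis by (simp add: Y_def)
      next
        case 6
        have "\<exists>b. a + \<sigma> a = 4 * b + 3 \<and> m + 1 \<le> b \<and> b \<le> 2 * m - 1"
        proof (cases "even a")
          case True
          then obtain b where "a = 2 * b" by blast
          then show ?thesis using up[OF 6(1)] 6 by (intro exI[of _ "b - 1"]) simp
        next
          case False
          then obtain b where "a = 2 * b + 1" by (blast elim: oddE)
          then show ?thesis using up[OF 6(1)] 6 by (intro exI[of _ b]) simp
        qed
        then obtain b where b: "a + \<sigma> a = 4 * b + 3" "m + 1 \<le> b" "b \<le> 2 * m - 1" by blast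
        have "(4 * b + 3) mod 4 = 3" by presburger
        then have "a + \<sigma> a \<in> Y" unfolding b(1) Y_def using b(2,3) by simp
        then show ?thesis ..
      qed
    qed
    have Y: "\<forall>y\<in>Y. odd y \<and> 1 \<le> y \<and> y \<le> 2 * d - 2" "\<forall>y\<in>Y. y + 2 \<notin> Y"
    proof (safe del: notI)
      fix y assume y: "y \<in> Y"
      then have mod: "y mod 4 = 1 \<or> y mod 4 = 3" by (auto simp: Y_def)
      then show "odd y" by presburger
      show "1 \<le> y" "y \<le> 2 * d - 2" using y m by (auto simp: Y_def 2)
      have "(y + 2) mod 4 = 3" if "y mod 4 = 1" using that by presburger
      moreover have "(y + 2) mod 4 = 1" if "y mod 4 = 3" using that by presburger
      ultimately show "y + 2 \<notin> Y" using y mod unfolding Y_def by auto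
    qed
    show thesis
    proof
      show "\<sigma> \<in> {0..<d} \<rightarrow> {0..<d}" using rng by blast
      show "inj_on \<sigma> {0..<d}" using invol by (metis inj_onI)
      show "\<bar>a - \<sigma> a\<bar> \<le> 1" for a by (simp add: \<sigma>_def)
      show "\<not> d dvd (a + \<sigma> a) - (b + \<sigma> b + 2)" if "a \<in> {0..<d}" "b \<in> {0..<d}" for a b
        using no_collision[OF Y sum[OF that(1)] sum[OF that(2)]] .
    qed
  qed
qed

text \<open>With \<open>h\<close> the inverse of 2 modulo \<open>d\<close>, the 4-cycle moves the points \<open>0, h, h - 1\<close>, which are
  the halves of the sums \<open>0, 1, -1\<close> to be avoided; its differences are \<open>h - 1\<close> and \<open>h + 1\<close>.\<close>

lemma exists_near_identity:
  fixes d :: int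
  assumes d: "d \<ge> 9" "odd d"
  obtains \<tau> :: "int \<Rightarrow> int"
  where "\<tau> \<in> {0..<d} \<rightarrow> {0..<d}" "inj_on \<tau> {0..<d}"
    "\<And>a k. a \<in> {0..<d} \<Longrightarrow> 1 \<le> k \<Longrightarrow> k \<le> 3 \<Longrightarrow> \<not> d dvd (a - \<tau> a) - k"
    "\<And>a k. a \<in> {0..<d} \<Longrightarrow> -1 \<le> k \<Longrightarrow> k \<le> 1 \<Longrightarrow> \<not> d dvd (a + \<tau> a) - k"
proof -
  have "d = 2 * ((d + 1) div 2) - 1" using d(2) by presburger
  then obtain h where h: "d = 2 * h - 1" by blast
  \<comment> \<open>Along the cycle the sums are \<open>h - 1\<close>, \<open>h\<close> or
    \<open>h + 1\<close>, and \<open>h \<ge> 5\<close> keeps sums and differences off the forbidden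
    residues. Points outside the cycle have difference 0.\<close>
  define \<tau> where "\<tau> a = (if a = 0 then h else if a = h then 1 else if a = 1 then h - 1
    else if a = h - 1 then 0 else a)" for a :: int
  show thesis
  proof
    show rng: "\<tau> \<in> {0..<d} \<rightarrow> {0..<d}" using d h by (auto simp: \<tau>_def)
    show "inj_on \<tau> {0..<d}" using d h by (auto simp: \<tau>_def inj_on_def split: if_splits)
    fix a k assume a: "a \<in> {0..<d}"
    then have ta: "\<tau> a \<in> {0..<d}" using rng by auto
    show "\<not> d dvd (a - \<tau> a) - k" if k: "1 \<le> k" "k \<le> 3"
    proof
      assume "d dvd (a - \<tau> a) - k"
      moreover have "\<bar>(a - \<tau> a) - k\<bar> < 3 * d" using a ta k d by auto
      ultimately show False
        using dvd_cases[of d "(a - \<tau> a) - k"] k d h a by (auto simp: \<tau>_def split: if_splits)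
    qed
    show "\<not> d dvd (a + \<tau> a) - k" if k: "-1 \<le> k" "k \<le> 1"
    proof
      assume "d dvd (a + \<tau> a) - k"
      moreover have "\<bar>(a + \<tau> a) - k\<bar> < 3 * d" using a ta k d by auto
      ultimately show False
        using dvd_cases[of d "(a + \<tau> a) - k"] k d h a by (auto simp: \<tau>_def split: if_splits; presburger)
    qed
  qed
qed

text \<open>The pairs are \<open>(a + 1, \<sigma> a - 1)\<close>,
  \<open>(a + 1, \<sigma> a + 1)\<close> and \<open>(a, \<tau> a)\<close>. The first two families
  have sums separated by the choice of \<sigma>. Their differences lie in \<open>{1, 2, 3}\<close>
  and \<open>{-1, 0, 1}\<close>, which the differences and the sums of \<tau> avoid,
  respectively.\<close>

lemma exists_skew_family_odd:
  assumes d: "d \<ge> 9" "odd d"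
  shows "\<exists>S. skew_family d S \<and> finite S \<and> card S = 3 * d"
proof -
  let ?I = "{0..<int d}"
  have d': "int d \<ge> 9" "odd (int d)" using d by simp_all
  obtain \<sigma> where \<sigma>: "\<sigma> \<in> ?I \<rightarrow> ?I" "inj_on \<sigma> ?I" "\<And>a. a \<in> ?I \<Longrightarrow> \<bar>a - \<sigma> a\<bar> \<le> 1"
    "\<And>a b. a \<in> ?I \<Longrightarrow> b \<in> ?I \<Longrightarrow> \<not> int d dvd (a + \<sigma> a) - (b + \<sigma> b + 2)"
    using exists_adjacent_swaps[OF d'] by blast
  obtain \<tau> where \<tau>: "\<tau> \<in> ?I \<rightarrow> ?I" "inj_on \<tau> ?I"
    "\<And>a k. a \<in> ?I \<Longrightarrow> 1 \<le> k \<Longrightarrow> k \<le> 3 \<Longrightarrow> \<not> int d dvd (a - \<tau> a) - k"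
    "\<And>a k. a \<in> ?I \<Longrightarrow> -1 \<le> k \<Longrightarrow> k \<le> 1 \<Longrightarrow> \<not> int d dvd (a + \<tau> a) - k"
    using exists_near_identity[OF d'] by blast
  have id: "(\<lambda>a. a) \<in> ?I \<rightarrow> ?I" "inj_on (\<lambda>a. a) ?I" by auto
  show ?thesis
  proof (rule skew_family_of_maps[where I = ?I and \<kappa> = "-1" and s = 0 and f = "\<lambda>a. a + 1" and f' = "\<lambda>a. \<sigma> a + (-1)"
      and g = "\<lambda>a. a + 1" and g' = "\<lambda>a. \<sigma> a + 1" and h = "\<lambda>a. a + 0" and h' = "\<lambda>a. \<tau> a + 0"])
    show "(- 1 :: complex) * - 1 = zeta d 0" by (simp add: zeta_def)
    fix a b assume ab: "a \<in> ?I" "b \<in> ?I"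
    have "\<not> int d dvd (a + \<sigma> a) - (b + \<sigma> b + 2)" using \<sigma>(4)[OF ab] .
    moreover have "(a + 1 + (\<sigma> a + - 1)) - (b + 1 + (\<sigma> b + 1)) = (a + \<sigma> a) - (b + \<sigma> b + 2)" by simp
    ultimately show "\<not> int d dvd (a + 1 + (\<sigma> a + - 1)) - (b + 1 + (\<sigma> b + 1))" by metis
    have "\<not> int d dvd (b - \<tau> b) - (a - \<sigma> a + 2)" using \<sigma>(3)[OF ab(1)] by (intro \<tau>(3) ab) auto
    then have "\<not> int d dvd - ((b - \<tau> b) - (a - \<sigma> a + 2))" by (simp only: dvd_minus_iff) simp
    moreover have "(a + 1 - (\<sigma> a + - 1)) - (b + 0 - (\<tau> b + 0)) = - ((b - \<tau> b) - (a - \<sigma> a + 2))" by simp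
    ultimately show "\<not> int d dvd (a + 1 - (\<sigma> a + - 1)) - (b + 0 - (\<tau> b + 0))" by metis
    have "\<not> int d dvd (b + \<tau> b) - (a - \<sigma> a)" using \<sigma>(3)[OF ab(1)] by (intro \<tau>(4) ab) auto
    then have "\<not> int d dvd - ((b + \<tau> b) - (a - \<sigma> a))" by (simp only: dvd_minus_iff) simp
    moreover have "(a + 1 - (\<sigma> a + 1)) - (b + 0 + (\<tau> b + 0) + 0) = - ((b + \<tau> b) - (a - \<sigma> a))" by simp
    ultimately show "\<not> int d dvd (a + 1 - (\<sigma> a + 1)) - (b + 0 + (\<tau> b + 0) + 0)" by metis
  qed (rule refl inj_mod_of_permutation[OF id] inj_mod_of_permutation[OF \<sigma>(1,2)]
      inj_mod_of_permutation[OF \<tau>(1,2)] | use d in simp)+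
qed

section \<open>Small odd degrees and the conclusion\<close>

text \<open>Two full families with constant sums 0 and 1 modulo 3; the third is empty.\<close>

lemma exists_skew_family_3: "\<exists>S. skew_family 3 S \<and> finite S \<and> card S = 6"
proof -
  have "\<exists>S. skew_family 3 S \<and> finite S \<and> card S
    = card {(0::int, 0::int), (1, 2), (2, 1)} + card {(0::int, 1::int), (1, 0), (2, 2)} + card ({} :: (int \<times> int) set)"
    by (rule skew_family_of_exponents[where \<kappa> = "-1" and s = 0]) (simp_all add: inj_mod_def zeta_def)
  then show ?thesis by (simp add: eval_nat_numeral)
qed

text \<open>Sizes 5, 4, 4. Modulo 5 the separated sets are \<open>{0, 2, 4}\<close> and
  \<open>{1, 3}\<close>, \<open>{0, 1, 4}\<close> and \<open>{2, 3}\<close>, \<open>{3, 4}\<close>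
  and \<open>{0, 2}\<close>.\<close>

lemma exists_skew_family_5: "\<exists>S. skew_family 5 S \<and> finite S \<and> card S = 13"
proof -
  have "\<exists>S. skew_family 5 S \<and> finite S \<and> card S
    = card {(0::int, 0::int), (1, 1), (2, 2), (3, 4), (4, 3)}
    + card {(0::int, 1::int), (1, 2), (2, 4), (3, 0)} + card {(0::int, 2::int), (1, 4), (2, 0), (4, 1)}"
    by (rule skew_family_of_exponents[where \<kappa> = "-1" and s = 0]) (simp_all add: inj_mod_def zeta_def)
  then show ?thesis by (simp add: eval_nat_numeral)
qed

text \<open>Three full families. Modulo 7 the separated sets are \<open>{0, 2, 4}\<close> and
  \<open>{1, 3, 5}\<close>, \<open>{0, 1, 6}\<close> and \<open>{3, 4, 5}\<close>,
  \<open>{0, 3, 6}\<close> and \<open>{1, 2, 5}\<close>.\<close>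

lemma exists_skew_family_7: "\<exists>S. skew_family 7 S \<and> finite S \<and> card S = 21"
proof -
  have "\<exists>S. skew_family 7 S \<and> finite S \<and> card S
    = card {(0::int, 0::int), (1, 1), (2, 2), (3, 4), (4, 3), (5, 6), (6, 5)}
    + card {(0::int, 1::int), (1, 2), (2, 3), (3, 0), (4, 4), (5, 5), (6, 6)}
    + card {(0::int, 2::int), (1, 4), (2, 6), (3, 5), (4, 1), (5, 0), (6, 3)}"
    by (rule skew_family_of_exponents[where \<kappa> = "-1" and s = 0]) (simp_all add: inj_mod_def zeta_def)
  then show ?thesis by (simp add: eval_nat_numeral)
qed

theorem theorem4p7:
  fixes d :: nat
  assumes "d \<ge> 3"
  shows "max_skew_lines d (if d = 3 then 6 else if d = 5 then 13 else 3 * d)"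
proof -
  have "\<exists>S. skew_family d S \<and> finite S \<and> card S = (if d = 3 then 6 else if d = 5 then 13 else 3 * d)"
  proof -
    have "even d \<or> d = 3 \<or> d = 5 \<or> d = 7 \<or> odd d \<and> d \<ge> 9" using assms by presburger
    then consider "even d" | "d = 3" | "d = 5" | "d = 7" | "odd d" "d \<ge> 9" by blast
    then show ?thesis
    proof cases
      case 1
      then show ?thesis using exists_skew_family_even[of d] assms by auto
    qed (use exists_skew_family_3 exists_skew_family_5 exists_skew_family_7 exists_skew_family_odd[of d] in auto)
  qed
  then show ?thesis
    using skew_family_card_le[OF assms] unfolding max_skew_lines_def by blast
qed

end
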